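(* Let $n$ and $d$ be positive integers. There exist nonsingular hypersurfaces $D_1,\ldots, D_n$ in $\mathbb{P}^n$ over $K$ of degree $d$, intersecting transversally, and a nonconstant analytic map $f:K\to \mathbb{P}^n$, with image not completely contained in any of the hypersurfaces $D_1,\ldots, D_n$, such that for all $r\geq 1$, $$\sum_{i=1}^n \frac{m_f(r,D_i)}{d}=\left(n-1+\frac{1}{d}\right)T_f(r)+O(1),$$ where the implied constant in $O(1)$ is independent of $r$.
   Context: $K$ is an algebraically closed field, of arbitrary characteristic, complete with respect to a non-archimedean absolute value $|\cdot|$. An entire function on $K$ is a power series $g(z)=\sum_{i\ge 0} a_iz^i$ with coefficients in $K$ converging on all of $K$; for real $r\geq 0$ put $|g|_r=\sup_i |a_i|r^i$. An analytic map $f:K\to\mathbb{P}^n$ is written $f=(f_0,\ldots,f_n)$ with $f_0,\ldots,f_n$ entire functions without a common zero. Put $\|f\|_r=\max\{|f_0|_r,\ldots,|f_n|_r\}$. The characteristic function is $T_f(r)=\log\|f\|_r$, well defined up to an additive constant independently of the representation of $f$. A hypersurface $D\subset\mathbb{P}^n$ of degree $d\geq 1$ is the closed subscheme defined by a homogeneous polynomial $Q\in K[x_0,\ldots,x_n]$ of degree $d$. If $Q\circ f=Q(f_0,\ldots,f_n)\not\equiv 0$, the proximity function is $$m_f(r,D)=\log\frac{\|f\|_r^d}{|Q\circ f|_r},$$ which depends on the choice of $Q$ only up to an additive constant. Transversality (standard meaning): nonsingular hypersurfaces $D_1,\ldots,D_n$ in $\mathbb{P}^n$ intersect transversally if for every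 subset $I\subset\{1,\ldots,n\}$ and every point $P\in\bigcap_{i\in I}D_i$, the intersection of the tangent spaces $T_PD_i$, $i\in I$, has codimension $|I|$ in $T_P\mathbb{P}^n$. *)

theory Defs
  imports
    "HOL-Analysis.Abstract_Metric_Spaces"
    "HOL-Computational_Algebra.Polynomial"
    "HOL-Computational_Algebra.Formal_Power_Series"
    "HOL-Library.Poly_Mapping"
    "HOL-Library.Function_Algebras"
begin

section \<open>Complete non-archimedean fields\<close>

text \<open>
  The class \<open>real_normed_field\<close> is not usable here: its absolute value is archimedean and the
  field has characteristic 0. The absolute value is therefore an explicit function. The trivial
  absolute value is not excluded.
\<close>

definition nonarch_abs :: "('a::field \<Rightarrow> real) \<Rightarrow> bool" where
  "nonarch_abs av \<longleftrightarrow>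
     (\<forall>x. 0 \<le> av x) \<and> (\<forall>x. av x = 0 \<longleftrightarrow> x = 0) \<and>
     (\<forall>x y. av (x * y) = av x * av y) \<and>
     (\<forall>x y. av (x + y) \<le> max (av x) (av y))"

definition abs_dist :: "('a::field \<Rightarrow> real) \<Rightarrow> 'a \<Rightarrow> 'a \<Rightarrow> real" where
  "abs_dist av x y = av (x - y)"

definition complete_abs :: "('a::field \<Rightarrow> real) \<Rightarrow> bool" where
  "complete_abs av \<longleftrightarrow> Metric_space.mcomplete UNIV (abs_dist av)"


section \<open>Entire functions\<close>

text \<open>An entire function is represented by its power series.\<close>

definition fps_converges_to :: "('a::field \<Rightarrow> real) \<Rightarrow> 'a fps \<Rightarrow> 'a \<Rightarrow> 'a \<Rightarrow> bool" where
  "fps_converges_to av g z s \<longleftrightarrow>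
     limitin (Metric_space.mtopology UNIV (abs_dist av))
       (\<lambda>N. \<Sum>i<N. fps_nth g i * z ^ i) s sequentially"

definition entire :: "('a::field \<Rightarrow> real) \<Rightarrow> 'a fps \<Rightarrow> bool" where
  "entire av g \<longleftrightarrow> (\<forall>z. \<exists>s. fps_converges_to av g z s)"

definition fps_value :: "('a::field \<Rightarrow> real) \<Rightarrow> 'a fps \<Rightarrow> 'a \<Rightarrow> 'a" where
  "fps_value av g z = (THE s. fps_converges_to av g z s)"

definition gauss_norm :: "('a::field \<Rightarrow> real) \<Rightarrow> 'a fps \<Rightarrow> real \<Rightarrow> real" where
  "gauss_norm av g r = (SUP i. av (fps_nth g i) * r ^ i)"


section \<open>Multivariate polynomials\<close>

text \<open>
  A polynomial is a finitely supported function from monomials to coefficients, a monomial being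
  a finitely supported function from variable indices to exponents.
\<close>

type_synonym 'a mpol = "(nat \<Rightarrow>\<^sub>0 nat) \<Rightarrow>\<^sub>0 'a"

text \<open>
  Substitution into a polynomial, where \<open>h\<close> maps the coefficients into the target ring: \<open>h = id\<close>
  for evaluation at a point, \<open>h = fps_const\<close> for composition with power series.
\<close>

definition mpol_subst :: "('a::zero \<Rightarrow> 'b::comm_semiring_1) \<Rightarrow> 'a mpol \<Rightarrow> (nat \<Rightarrow> 'b) \<Rightarrow> 'b" where
  "mpol_subst h Q x =
     (\<Sum>m\<in>Poly_Mapping.keys Q. h (Poly_Mapping.lookup Q m) *
        (\<Prod>i\<in>Poly_Mapping.keys m. x i ^ Poly_Mapping.lookup m i))"

definition mpol_eval :: "'a::comm_semiring_1 mpol \<Rightarrow> (nat \<Rightarrow> 'a) \<Rightarrow> 'a" where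
  "mpol_eval Q x = mpol_subst id Q x"

definition mpol_compose :: "'a::comm_semiring_1 mpol \<Rightarrow> (nat \<Rightarrow> 'a fps) \<Rightarrow> 'a fps" where
  "mpol_compose Q f = mpol_subst fps_const Q f"

text \<open>
  The formal partial derivative. If the exponent of the variable is 0, the truncating subtraction
  of exponents is harmless because the coefficient is 0.
\<close>

definition mpol_pderiv :: "nat \<Rightarrow> 'a::comm_semiring_1 mpol \<Rightarrow> 'a mpol" where
  "mpol_pderiv i Q =
     (\<Sum>m\<in>Poly_Mapping.keys Q.
        Poly_Mapping.single (m - Poly_Mapping.single i 1)
          (of_nat (Poly_Mapping.lookup m i) * Poly_Mapping.lookup Q m))"

definition homogeneous_mpol :: "nat \<Rightarrow> nat \<Rightarrow> 'a::zero mpol \<Rightarrow> bool" where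
  "homogeneous_mpol n d Q \<longleftrightarrow>
     (\<forall>m\<in>Poly_Mapping.keys Q. Poly_Mapping.keys m \<subseteq> {..n} \<and>
        (\<Sum>i\<le>n. Poly_Mapping.lookup m i) = d)"


section \<open>Hypersurfaces in projective space\<close>

text \<open>
  \<open>coord_space n\<close> is \<open>K\<^sup>n\<^sup>+\<^sup>1\<close>, as functions vanishing beyond index \<open>n\<close>. A point of projective
  space is given by homogeneous coordinates, and a hypersurface by a defining polynomial.
\<close>

definition coord_space :: "nat \<Rightarrow> (nat \<Rightarrow> 'a::zero) set" where
  "coord_space n = {v. \<forall>i>n. v i = 0}"

definition hom_coords :: "nat \<Rightarrow> (nat \<Rightarrow> 'a::zero) set" where
  "hom_coords n = coord_space n - {\<lambda>_. 0}"

definition same_point :: "nat \<Rightarrow> (nat \<Rightarrow> 'a::field) \<Rightarrow> (nat \<Rightarrow> 'a) \<Rightarrow> bool" where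
  "same_point n x y \<longleftrightarrow> (\<exists>c. c \<noteq> 0 \<and> (\<forall>i\<le>n. x i = c * y i))"

definition hypersurface :: "nat \<Rightarrow> nat \<Rightarrow> 'a::field mpol \<Rightarrow> bool" where
  "hypersurface n d Q \<longleftrightarrow> Q \<noteq> 0 \<and> homogeneous_mpol n d Q"

text \<open>
  Nonsingularity, over an algebraically closed field. The condition \<open>Q = 0\<close> has to be stated:
  when the characteristic divides the degree, it does not follow from the vanishing of the
  partial derivatives.
\<close>

definition nonsingular_hypersurface :: "nat \<Rightarrow> 'a::field mpol \<Rightarrow> bool" where
  "nonsingular_hypersurface n Q \<longleftrightarrow>
     (\<forall>p\<in>hom_coords n. mpol_eval Q p = 0 \<longrightarrow> (\<exists>i\<le>n. mpol_eval (mpol_pderiv i Q) p \<noteq> 0))"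

definition fun_scale :: "'a::field \<Rightarrow> (nat \<Rightarrow> 'a) \<Rightarrow> nat \<Rightarrow> 'a" where
  "fun_scale c v = (\<lambda>i. c * v i)"

lemma vector_space_fun_scale: "vector_space fun_scale"
  by unfold_locales (auto simp: fun_scale_def algebra_simps fun_eq_iff)

text \<open>
  The tangent space of projective space at the point \<open>p\<close> is (up to a twist) the quotient of
  \<open>coord_space n\<close> by the line spanned by \<open>p\<close>. The tangent space at \<open>p\<close> of the hypersurface
  \<open>Q = 0\<close> through \<open>p\<close> is the image in this quotient of the kernel of the differential of \<open>Q\<close>
  at \<open>p\<close>, and this kernel contains \<open>p\<close> by Euler's identity. Subspaces of the tangent space are
  represented by their preimages in \<open>coord_space n\<close>, and \<open>quot_dim p W\<close> is the dimension of the
  quotient of \<open>W\<close> by the line spanned by \<open>p\<close>.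
\<close>

definition proj_tangent :: "nat \<Rightarrow> 'a::field mpol \<Rightarrow> (nat \<Rightarrow> 'a) \<Rightarrow> (nat \<Rightarrow> 'a) set" where
  "proj_tangent n Q p =
     {v \<in> coord_space n. (\<Sum>i\<le>n. mpol_eval (mpol_pderiv i Q) p * v i) = 0}"

definition quot_dim :: "(nat \<Rightarrow> 'a::field) \<Rightarrow> (nat \<Rightarrow> 'a) set \<Rightarrow> nat" where
  "quot_dim p W = vector_space.dim fun_scale W - vector_space.dim fun_scale {p}"

definition intersect_transversally ::
    "nat \<Rightarrow> 'i set \<Rightarrow> ('i \<Rightarrow> 'a::field mpol) \<Rightarrow> bool" where
  "intersect_transversally n J Q \<longleftrightarrow>
     (\<forall>I\<subseteq>J. \<forall>p\<in>hom_coords n. (\<forall>i\<in>I. mpol_eval (Q i) p = 0) \<longrightarrow>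
        quot_dim p (coord_space n \<inter> (\<Inter>i\<in>I. proj_tangent n (Q i) p)) + card I
          = quot_dim p (coord_space n))"


section \<open>Analytic maps to projective space\<close>

definition analytic_map :: "('a::field \<Rightarrow> real) \<Rightarrow> nat \<Rightarrow> (nat \<Rightarrow> 'a fps) \<Rightarrow> bool" where
  "analytic_map av n f \<longleftrightarrow>
     (\<forall>i\<le>n. entire av (f i)) \<and> (\<forall>z. \<exists>i\<le>n. fps_value av (f i) z \<noteq> 0)"

definition map_value :: "('a::field \<Rightarrow> real) \<Rightarrow> (nat \<Rightarrow> 'a fps) \<Rightarrow> 'a \<Rightarrow> nat \<Rightarrow> 'a" where
  "map_value av f z = (\<lambda>i. fps_value av (f i) z)"

definition nonconstant_map :: "('a::field \<Rightarrow> real) \<Rightarrow> nat \<Rightarrow> (nat \<Rightarrow> 'a fps) \<Rightarrow> bool" where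
  "nonconstant_map av n f \<longleftrightarrow>
     (\<exists>z w. \<not> same_point n (map_value av f z) (map_value av f w))"

definition image_contained_in :: "('a::field \<Rightarrow> real) \<Rightarrow> (nat \<Rightarrow> 'a fps) \<Rightarrow> 'a mpol \<Rightarrow> bool" where
  "image_contained_in av f Q \<longleftrightarrow> (\<forall>z. mpol_eval Q (map_value av f z) = 0)"

definition map_norm :: "('a::field \<Rightarrow> real) \<Rightarrow> nat \<Rightarrow> (nat \<Rightarrow> 'a fps) \<Rightarrow> real \<Rightarrow> real" where
  "map_norm av n f r = Max ((\<lambda>i. gauss_norm av (f i) r) ` {..n})"

definition characteristic_fun :: "('a::field \<Rightarrow> real) \<Rightarrow> nat \<Rightarrow> (nat \<Rightarrow> 'a fps) \<Rightarrow> real \<Rightarrow> real" where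
  "characteristic_fun av n f r = ln (map_norm av n f r)"

text \<open>
  \<open>proximity_fun av n d f Q r\<close>, where \<open>d\<close> is the degree of the hypersurface \<open>Q = 0\<close>; meaningful
  if \<open>mpol_compose Q f \<noteq> 0\<close> and \<open>r > 0\<close>.
\<close>

definition proximity_fun ::
    "('a::field \<Rightarrow> real) \<Rightarrow> nat \<Rightarrow> nat \<Rightarrow> (nat \<Rightarrow> 'a fps) \<Rightarrow> 'a mpol \<Rightarrow> real \<Rightarrow> real" where
  "proximity_fun av n d f Q r =
     ln (map_norm av n f r ^ d / gauss_norm av (mpol_compose Q f) r)"

end

theory Submission
  imports Defs "HOL-Computational_Algebra.Polynomial_FPS"
begin

text \<open>
  For \<open>f\<close> take the affine parametrization \<open>(z : 1 : 0 : \<dots> : 0)\<close> of the line \<open>L\<close> on which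
  \<open>x\<^sub>2, \<dots>, x\<^sub>n\<close> vanish. It omits only the point \<open>P = (1 : 0 : \<dots> : 0)\<close> of \<open>L\<close>, and \<open>T\<^sub>f(r) = log r\<close> for
  \<open>r \<ge> 1\<close>. Each \<open>Q\<^sub>i \<circ> f\<close> is a polynomial in \<open>z\<close>, of degree \<open>d\<close> minus the intersection multiplicity of
  \<open>L\<close> and \<open>D\<^sub>i\<close> at \<open>P\<close>. As \<open>log |q|\<^sub>r = deg q \<cdot> log r + O(1)\<close> for a polynomial \<open>q \<noteq> 0\<close>, the claim
  amounts to \<open>\<Sum>\<^sub>i deg (Q\<^sub>i \<circ> f) = d - 1\<close> (\<open>proximity_sum_line_map\<close>). This holds if \<open>D\<^sub>1, \<dots>, D\<^sub>n\<^sub>-\<^sub>1\<close>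
  meet \<open>L\<close> in \<open>P\<close> alone, with multiplicity \<open>d\<close>, and \<open>D\<^sub>n\<close> meets \<open>L\<close> in \<open>P\<close> with multiplicity 1.
  Transversality does not exclude this: the tangent hyperplanes of \<open>D\<^sub>1, \<dots>, D\<^sub>n\<^sub>-\<^sub>1\<close> at \<open>P\<close> may meet
  exactly in \<open>L\<close>.

  It remains to find the hypersurfaces. Let \<open>Q\<^sub>i\<close> be a sum of terms \<open>c\<^sub>i\<^sub>j\<^sub>l x\<^sub>j\<^sup>d\<^sup>-\<^sup>1 x\<^sub>l\<close>. The restriction of
  \<open>Q\<^sub>i\<close> to \<open>L\<close> depends only on the coefficients with \<open>j, l \<le> 1\<close>; these are chosen so that it is \<open>x\<^sub>1\<^sup>d\<close>
  for \<open>i < n\<close>, and for \<open>i = n\<close> it is only required that \<open>Q\<^sub>n(P) = 0\<close>. All other coefficients are generic,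
  which also makes the multiplicity of \<open>D\<^sub>n\<close> at \<open>P\<close> equal to 1.
  Then the intersection is transversal, by a dimension count that works in every characteristic.
  If it is not, there are a point \<open>p\<close> and multipliers \<open>\<lambda>\<^sub>i\<close> (\<open>i \<in> I\<close>), say with \<open>p\<^sub>j = 1\<close> and one
  \<open>\<lambda>\<^sub>i = 1\<close>, such that \<open>Q\<^sub>i(p) = 0\<close> for \<open>i \<in> I\<close> and \<open>\<Sum> \<lambda>\<^sub>i \<nabla>Q\<^sub>i(p) = 0\<close>. The coefficients of the
  \<open>x\<^sub>j\<^sup>d\<^sup>-\<^sup>1 x\<^sub>l\<close> occur linearly in these equations, and \<open>n + |I|\<close> of the equations can be solved for \<open>n + |I|\<close> of
  these coefficients, with polynomials as solutions, while \<open>p\<close> and \<open>\<lambda>\<close> have only \<open>n + |I| - 1\<close>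
  free entries. So the bad coefficient vectors lie in the images of finitely many polynomial maps in
  fewer variables than there are coefficients (\<open>degenerate_coeffs_cover\<close>). Where some of the
  \<open>c\<^sub>i\<^sub>j\<^sub>l\<close> are prescribed, that is on \<open>L\<close>, only \<open>Q\<^sub>n\<close> can vanish away from \<open>P\<close>, and the tangent spaces
  at \<open>P\<close> lead to a similar count (\<open>dependent_tangent_coeffs_cover\<close>).

  Such images do not cover the coefficient space: by counting monomials, the components of a polynomial
  map in fewer variables satisfy a polynomial relation, and a nonzero polynomial has only finitely many
  zeros on the curve \<open>t \<mapsto> (t, t\<^sup>N, t\<^bsup>N*N\<^esup>, \<dots>)\<close> when \<open>N\<close> exceeds its degree in each variable
  (\<open>curve_meets_image_finitely\<close>).

  For \<open>d = 1\<close> the hyperplanes \<open>x\<^sub>1 + x\<^sub>2, \<dots>, x\<^sub>1 + x\<^sub>n, x\<^sub>1\<close> have the same properties.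
\<close>


section \<open>Polynomial maps in fewer variables\<close>

interpretation fun_vs: vector_space "\<lambda>(c::'a::field) (g::'b \<Rightarrow> 'a) x. c * g x"
  by unfold_locales (auto simp: algebra_simps fun_eq_iff)

inductive_set poly_functions :: "'i set \<Rightarrow> (('i \<Rightarrow> 'a::field) \<Rightarrow> 'a) set" for X where
  const: "(\<lambda>_. c) \<in> poly_functions X"
| coordinate: "s \<in> X \<Longrightarrow> (\<lambda>y. y s) \<in> poly_functions X"
| add: "g \<in> poly_functions X \<Longrightarrow> h \<in> poly_functions X \<Longrightarrow> (\<lambda>y. g y + h y) \<in> poly_functions X"
| mult: "g \<in> poly_functions X \<Longrightarrow> h \<in> poly_functions X \<Longrightarrow> (\<lambda>y. g y * h y) \<in> poly_functions X"

lemma poly_functions_uminus: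
  "g \<in> poly_functions X \<Longrightarrow> (\<lambda>y. - g y) \<in> poly_functions X"
  using poly_functions.mult[OF poly_functions.const[of "-1"], of g X] by simp

lemma poly_functions_diff:
  "g \<in> poly_functions X \<Longrightarrow> h \<in> poly_functions X \<Longrightarrow> (\<lambda>y. g y - h y) \<in> poly_functions X"
  using poly_functions.add[OF _ poly_functions_uminus, of g X h] by simp

lemma poly_functions_power:
  "g \<in> poly_functions X \<Longrightarrow> (\<lambda>y. g y ^ k) \<in> poly_functions X"
  by (induction k) (auto intro: poly_functions.const poly_functions.mult)

lemma poly_functions_sum:
  "(\<And>i. i \<in> A \<Longrightarrow> g i \<in> poly_functions X) \<Longrightarrow> (\<lambda>y. \<Sum>i\<in>A. g i y) \<in> poly_functions X"
  by (induction A rule: infinite_finite_induct)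
     (auto intro: poly_functions.const poly_functions.add)

lemma poly_functions_if:
  "(P \<Longrightarrow> g \<in> poly_functions X) \<Longrightarrow> (\<not> P \<Longrightarrow> h \<in> poly_functions X) \<Longrightarrow>
    (\<lambda>y. if P then g y else h y) \<in> poly_functions X"
  by (cases P) simp_all

lemmas poly_functions_intros = poly_functions.intros poly_functions_uminus poly_functions_diff
  poly_functions_power poly_functions_sum poly_functions_if

text \<open>
  The exponents are bounded in each variable separately, so that the monomials are counted by a plain
  power.
\<close>

definition bounded_monomials :: "'i set \<Rightarrow> nat \<Rightarrow> (('i \<Rightarrow> 'a::field) \<Rightarrow> 'a) set" where
  "bounded_monomials X e = (\<lambda>b y. \<Prod>s\<in>X. y s ^ b s) ` (X \<rightarrow>\<^sub>E {..e})"

lemma finite_bounded_monomials: "finite X \<Longrightarrow> finite (bounded_monomials X e)"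
  by (simp add: bounded_monomials_def finite_PiE)

lemma card_bounded_monomials_le:
  assumes "finite X"
  shows "card (bounded_monomials X e) \<le> (e + 1) ^ card X"
proof -
  have "card (bounded_monomials X e) \<le> card (X \<rightarrow>\<^sub>E {..e})"
    unfolding bounded_monomials_def using assms by (intro card_image_le finite_PiE) auto
  then show ?thesis using assms by (simp add: card_PiE)
qed

lemma bounded_monomials_mono:
  "e \<le> e' \<Longrightarrow> bounded_monomials X e \<subseteq> bounded_monomials X e'"
  unfolding bounded_monomials_def by (intro image_mono PiE_mono) auto

lemma span_bounded_monomials_mono:
  "g \<in> fun_vs.span (bounded_monomials X e) \<Longrightarrow> e \<le> e' \<Longrightarrow>
    g \<in> fun_vs.span (bounded_monomials X e')"
  using fun_vs.span_mono[OF bounded_monomials_mono] by blast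

lemma bounded_monomials_mult:
  assumes "g \<in> bounded_monomials X e" "h \<in> bounded_monomials X e'"
  shows "(\<lambda>y. g y * h y) \<in> bounded_monomials X (e + e')"
proof -
  obtain b b' where b: "b \<in> X \<rightarrow>\<^sub>E {..e}" "b' \<in> X \<rightarrow>\<^sub>E {..e'}"
    and gh: "g = (\<lambda>y. \<Prod>s\<in>X. y s ^ b s)" "h = (\<lambda>y. \<Prod>s\<in>X. y s ^ b' s)"
    using assms by (auto simp: bounded_monomials_def)
  have "(\<lambda>s\<in>X. b s + b' s) \<in> X \<rightarrow>\<^sub>E {..e + e'}"
    using b by (auto simp: PiE_iff intro: add_mono)
  moreover have "(\<lambda>y. g y * h y) = (\<lambda>y. \<Prod>s\<in>X. y s ^ (\<lambda>s\<in>X. b s + b' s) s)"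
    by (simp add: gh power_add prod.distrib)
  ultimately show ?thesis unfolding bounded_monomials_def by blast
qed

lemma span_bounded_monomials_mult:
  fixes g h :: "('i \<Rightarrow> 'a::field) \<Rightarrow> 'a"
  assumes g: "g \<in> fun_vs.span (bounded_monomials X e)"
    and h: "h \<in> fun_vs.span (bounded_monomials X e')"
  shows "(\<lambda>y. g y * h y) \<in> fun_vs.span (bounded_monomials X (e + e'))"
proof -
  have *: "(\<lambda>y. m y * h y) \<in> fun_vs.span (bounded_monomials X (e + e'))"
    if m: "m \<in> bounded_monomials X e" for m :: "('i \<Rightarrow> 'a) \<Rightarrow> 'a"
    using h
  proof (induction rule: fun_vs.span_induct_alt)
    case base
    show ?case using fun_vs.span_zero by (simp add: zero_fun_def)
  next
    case (step c m' r)
    have "(\<lambda>y. c * (m y * m' y)) + (\<lambda>y. m y * r y) \<in> fun_vs.span (bounded_monomials X (e + e'))"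
      by (intro fun_vs.span_add fun_vs.span_scale fun_vs.span_base
          bounded_monomials_mult[OF m step(1)] step(2))
    then show ?case by (simp add: plus_fun_def algebra_simps)
  qed
  show ?thesis using g
  proof (induction rule: fun_vs.span_induct_alt)
    case base
    show ?case using fun_vs.span_zero by (simp add: zero_fun_def)
  next
    case (step c m r)
    have "(\<lambda>y. c * (m y * h y)) + (\<lambda>y. r y * h y) \<in> fun_vs.span (bounded_monomials X (e + e'))"
      by (intro fun_vs.span_add fun_vs.span_scale *[OF step(1)] step(2))
    then show ?case by (simp add: plus_fun_def algebra_simps)
  qed
qed

lemma span_bounded_monomials_const:
  "(\<lambda>_. c) \<in> fun_vs.span (bounded_monomials X e)"
proof -
  have "(\<lambda>y. 1) \<in> bounded_monomials X e"
    unfolding bounded_monomials_def by (rule image_eqI[of _ _ "\<lambda>s\<in>X. 0"]) auto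
  from fun_vs.span_scale[OF fun_vs.span_base[OF this], of c] show ?thesis by simp
qed

lemma span_bounded_monomials_power:
  assumes "g \<in> fun_vs.span (bounded_monomials X e)"
  shows "(\<lambda>y. g y ^ k) \<in> fun_vs.span (bounded_monomials X (k * e))"
proof (induction k)
  case 0
  show ?case using span_bounded_monomials_const[of 1] by simp
next
  case (Suc k)
  then show ?case using span_bounded_monomials_mult[OF assms Suc] by simp
qed

lemma span_bounded_monomials_prod:
  assumes "finite S" "\<And>s. s \<in> S \<Longrightarrow> g s \<in> fun_vs.span (bounded_monomials X e)"
  shows "(\<lambda>y. \<Prod>s\<in>S. g s y) \<in> fun_vs.span (bounded_monomials X (card S * e))"
  using assms
proof (induction S)
  case empty
  show ?case using span_bounded_monomials_const[of 1] by simp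
next
  case (insert s S)
  then show ?case using span_bounded_monomials_mult[of "g s" X e] by simp
qed

lemma poly_functions_span:
  fixes g :: "('i \<Rightarrow> 'a::field) \<Rightarrow> 'a"
  assumes "finite X" "g \<in> poly_functions X"
  shows "\<exists>e. g \<in> fun_vs.span (bounded_monomials X e)"
  using assms(2)
proof induction
  case (const c)
  show ?case using span_bounded_monomials_const by blast
next
  case (coordinate s)
  have "(\<lambda>y. y s) = (\<lambda>y :: 'i \<Rightarrow> 'a. \<Prod>r\<in>X. y r ^ (\<lambda>r\<in>X. if r = s then 1 else 0) r)"
  proof
    fix y :: "'i \<Rightarrow> 'a"
    have "(\<Prod>r\<in>X. y r ^ (\<lambda>r\<in>X. if r = s then 1 else 0) r) = (\<Prod>r\<in>X. if r = s then y r else 1)"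
      by (rule prod.cong) auto
    then show "y s = (\<Prod>r\<in>X. y r ^ (\<lambda>r\<in>X. if r = s then 1 else 0) r)"
      using coordinate assms(1) by simp
  qed
  moreover have "(\<lambda>r\<in>X. if r = s then 1 else 0) \<in> X \<rightarrow>\<^sub>E {..1::nat}" by auto
  ultimately have "(\<lambda>y :: 'i \<Rightarrow> 'a. y s) \<in> bounded_monomials X 1"
    unfolding bounded_monomials_def by (rule image_eqI)
  then show ?case using fun_vs.span_base by blast
next
  case (add g h)
  then obtain e e' where "g \<in> fun_vs.span (bounded_monomials X e)"
    "h \<in> fun_vs.span (bounded_monomials X e')" by blast
  then have "g + h \<in> fun_vs.span (bounded_monomials X (max e e'))"
    by (intro fun_vs.span_add) (auto elim: span_bounded_monomials_mono)
  then show ?case by (auto simp: plus_fun_def)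
next
  case (mult g h)
  then show ?case using span_bounded_monomials_mult by blast
qed

text \<open>
  Linear dependence for a family instead of a set: two equal members already are a relation.
\<close>

lemma (in vector_space) linear_relation_of_family:
  fixes f :: "nat \<Rightarrow> 'b"
  assumes "finite T" "card T < m" and f: "\<And>k. k < m \<Longrightarrow> f k \<in> span T"
  obtains h where "\<exists>k<m. h k \<noteq> 0" "(\<Sum>k<m. scale (h k) (f k)) = 0"
proof (cases "inj_on f {..<m}")
  case True
  let ?S = "f ` {..<m}"
  have "card ?S = m" using True by (simp add: card_image)
  then have "dependent ?S"
    using independent_span_bound[OF assms(1), of ?S] f assms(2) by fastforce
  then obtain u where u: "\<exists>v\<in>?S. u v \<noteq> 0" "(\<Sum>v\<in>?S. scale (u v) v) = 0"
    using dependent_finite[of ?S] by auto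
  have "(\<Sum>k<m. scale (u (f k)) (f k)) = 0"
    using u(2) by (simp add: sum.reindex[OF True])
  with u(1) that[of "u \<circ> f"] show thesis by auto
next
  case False
  then obtain k l where kl: "k < m" "l < m" "k \<noteq> l" "f k = f l"
    by (auto simp: inj_on_def)
  define h :: "nat \<Rightarrow> 'a" where "h = (\<lambda>i. if i = k then 1 else if i = l then -1 else 0)"
  have "(\<Sum>i<m. scale (h i) (f i)) = (\<Sum>i\<in>{k,l}. scale (h i) (f i))"
    by (rule sum.mono_neutral_right) (use kl in \<open>auto simp: h_def\<close>)
  also have "\<dots> = 0" using kl by (simp add: h_def)
  finally have "(\<Sum>i<m. scale (h i) (f i)) = 0" .
  moreover have "h k \<noteq> 0" by (simp add: h_def)
  ultimately show thesis using that kl(1) by blast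
qed

text \<open>
  The expansion of \<open>k\<close> in base \<open>N\<close>, cut off after \<open>M\<close> digits.
\<close>

lemma sum_digits:
  assumes "N > 0"
  shows "(\<Sum>i<M. (k div N ^ i mod N) * N ^ i) = k mod (N ^ M :: nat)"
proof (induction M)
  case (Suc M)
  have "k mod (N ^ M * N) = N ^ M * (k div N ^ M mod N) + k mod N ^ M"
    by (rule mod_mult2_eq)
  with Suc show ?case by (simp add: mult.commute)
qed simp

text \<open>
  The \<open>N ^ card S\<close> monomials in the components of \<open>F\<close> with exponents below \<open>N\<close> have exponents \<open>O(N)\<close>
  in the variables of \<open>X\<close>, so they lie in a space of dimension \<open>O(N ^ card X)\<close> and are linearly dependent
  for large \<open>N\<close>. On the curve, the monomial whose exponents are the base-\<open>N\<close> digits of \<open>k\<close> becomes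
  \<open>t ^ k\<close> (Kronecker substitution). Hence a linear relation between the monomials becomes a nonzero
  polynomial in \<open>t\<close> that vanishes wherever the curve meets the image of \<open>F\<close>.
\<close>

lemma curve_meets_image_finitely:
  fixes F :: "('i \<Rightarrow> 'a::field) \<Rightarrow> 'i \<Rightarrow> 'a" and \<sigma> :: "'i \<Rightarrow> nat"
  assumes S: "finite S" "X \<subset> S" and \<sigma>: "bij_betw \<sigma> S {..<card S}"
    and F: "\<And>s. s \<in> S \<Longrightarrow> (\<lambda>y. F y s) \<in> poly_functions X"
  shows "\<exists>N\<^sub>0. \<forall>N\<ge>N\<^sub>0. finite {t. \<exists>y. \<forall>s\<in>S. F y s = t ^ (N ^ \<sigma> s)}"
proof -
  let ?M = "card S"
  have X: "finite X" using S by (auto intro: finite_subset)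
  have cX: "card X < ?M" using S by (simp add: psubset_card_mono)
  have "\<forall>s\<in>S. \<exists>e. (\<lambda>y. F y s) \<in> fun_vs.span (bounded_monomials X e)"
    using poly_functions_span[OF X F] by blast
  then obtain e where e: "\<And>s. s \<in> S \<Longrightarrow> (\<lambda>y. F y s) \<in> fun_vs.span (bounded_monomials X (e s))"
    by metis
  define E where "E = (\<Sum>s\<in>S. e s)"
  have E: "(\<lambda>y. F y s) \<in> fun_vs.span (bounded_monomials X E)" if "s \<in> S" for s
    using span_bounded_monomials_mono[OF e[OF that]] that S(1)
    by (simp add: E_def member_le_sum)
  \<comment> \<open>For \<open>N \<ge> N0\<close> the number \<open>(?M * N * E + 1) ^ card X\<close> of monomials in \<open>X\<close> is at most
    \<open>N ^ card X * (?M * E + 1) ^ card X < N ^ (card X + 1)\<close>.\<close>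
  define N0 where "N0 = (?M * E + 1) ^ card X + 1"
  show ?thesis
  proof (intro exI[of _ N0] allI impI)
    fix N assume N: "N \<ge> N0"
    then have N0: "N > 0" by (simp add: N0_def)
    define \<delta> where "\<delta> = (\<lambda>k s. k div N ^ \<sigma> s mod N)"
    define \<Phi> where "\<Phi> = (\<lambda>k y. \<Prod>s\<in>S. F y s ^ \<delta> k s)"
    let ?T = "bounded_monomials X (?M * (N * E)) :: (('i \<Rightarrow> 'a) \<Rightarrow> 'a) set"
    have \<Phi>: "\<Phi> k \<in> fun_vs.span ?T" for k
      unfolding \<Phi>_def
    proof (rule span_bounded_monomials_prod[OF S(1)])
      fix s assume "s \<in> S"
      have "\<delta> k s \<le> N" using N0 by (simp add: \<delta>_def less_imp_le)
      then show "(\<lambda>y. F y s ^ \<delta> k s) \<in> fun_vs.span (bounded_monomials X (N * E))"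
        by (intro span_bounded_monomials_mono[OF span_bounded_monomials_power[OF E[OF \<open>s \<in> S\<close>]]])
           simp
    qed
    have "card ?T \<le> (?M * (N * E) + 1) ^ card X"
      by (rule card_bounded_monomials_le[OF X])
    also have "\<dots> \<le> (N * (?M * E + 1)) ^ card X"
      using N0 by (intro power_mono) (auto simp: algebra_simps)
    also have "\<dots> = N ^ card X * (?M * E + 1) ^ card X" by (simp only: power_mult_distrib)
    also have "\<dots> < N ^ card X * N"
      using N N0 by (intro mult_strict_left_mono) (auto simp: N0_def)
    also have "\<dots> = N ^ (card X + 1)" by simp
    also have "\<dots> \<le> N ^ ?M" using cX N0 by (intro power_increasing) auto
    finally have "card ?T < N ^ ?M" .
    from fun_vs.linear_relation_of_family[OF finite_bounded_monomials[OF X] this \<Phi>]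
    obtain h where h: "\<exists>k<N ^ ?M. h k \<noteq> 0"
      and rel: "(\<Sum>k<N ^ ?M. (\<lambda>y. h k * \<Phi> k y)) = 0" .
    have rel: "(\<Sum>k<N ^ ?M. h k * \<Phi> k y) = 0" for y
    proof -
      have "(\<Sum>k\<in>A. (\<lambda>y. h k * \<Phi> k y)) y = (\<Sum>k\<in>A. h k * \<Phi> k y)" for A
        by (induction A rule: infinite_finite_induct) auto
      with rel show ?thesis by (metis zero_fun_apply)
    qed
    define q where "q = (\<Sum>k<N ^ ?M. monom (h k) k)"
    have "q \<noteq> 0"
    proof -
      obtain k where k: "k < N ^ ?M" "h k \<noteq> 0" using h by blast
      have "coeff q k = h k" using k(1) by (simp add: q_def coeff_sum)
      with k(2) show ?thesis by auto
    qed
    have "{t. \<exists>y. \<forall>s\<in>S. F y s = t ^ (N ^ \<sigma> s)} \<subseteq> {t. poly q t = 0}"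
    proof clarify
      fix t y assume y: "\<forall>s\<in>S. F y s = t ^ (N ^ \<sigma> s)"
      have "\<Phi> k y = t ^ k" if "k < N ^ ?M" for k
      proof -
        have "\<Phi> k y = t ^ (\<Sum>s\<in>S. \<delta> k s * N ^ \<sigma> s)"
          using y by (simp add: \<Phi>_def power_sum flip: power_mult) (simp add: mult.commute)
        also have "(\<Sum>s\<in>S. \<delta> k s * N ^ \<sigma> s) = (\<Sum>i<?M. (k div N ^ i mod N) * N ^ i)"
          unfolding \<delta>_def by (rule sum.reindex_bij_betw[OF \<sigma>])
        also have "\<dots> = k" using sum_digits[OF N0] that by simp
        finally show ?thesis .
      qed
      then show "poly q t = 0"
        using rel[of y] by (simp add: q_def poly_sum poly_monom)
    qed
    then show "finite {t. \<exists>y. \<forall>s\<in>S. F y s = t ^ (N ^ \<sigma> s)}"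
      using poly_roots_finite[OF \<open>q \<noteq> 0\<close>] finite_subset by blast
  qed
qed

lemma infinite_UNIV_alg_closed_field: "infinite (UNIV :: 'a::alg_closed_field set)"
proof
  assume fin: "finite (UNIV :: 'a set)"
  define p :: "'a poly" where "p = (\<Prod>a\<in>UNIV. [:-a, 1:])"
  have "degree p = card (UNIV :: 'a set)"
    unfolding p_def by (subst degree_prod_eq_sum_degree) auto
  then have "degree (p + 1) > 0"
    using fin by (subst degree_add_eq_left) (auto simp: card_gt_0_iff)
  then obtain x where "poly (p + 1) x = 0" using alg_closed_imp_poly_has_root by blast
  moreover have "poly p x = 0" using fin by (auto simp: p_def poly_prod)
  ultimately show False by simp
qed

text \<open>
  A map that ignores one of the coordinates in \<open>S\<close> is a map in fewer variables. All maps are avoided on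
  one curve, by taking \<open>N\<close> large enough for each of them; the values off \<open>S\<close> are prescribed by \<open>b\<close>.
\<close>

lemma point_outside_polynomial_images:
  fixes \<F> :: "(('i \<Rightarrow> 'a::alg_closed_field) \<Rightarrow> 'i \<Rightarrow> 'a) set"
  assumes S: "finite S" and \<F>: "finite \<F>"
    and F: "\<And>F. F \<in> \<F> \<Longrightarrow> \<exists>s\<^sub>0\<in>S. \<forall>s\<in>S. (\<lambda>y. F y s) \<in> poly_functions (S - {s\<^sub>0})"
  obtains c where "\<And>s. s \<notin> S \<Longrightarrow> c s = b s" "\<And>F y. F \<in> \<F> \<Longrightarrow> \<exists>s\<in>S. F y s \<noteq> c s"
proof -
  obtain \<sigma> :: "'i \<Rightarrow> nat" where \<sigma>: "bij_betw \<sigma> S {..<card S}"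
    using ex_bij_betw_finite_nat[OF S] by (auto simp: atLeast0LessThan)
  have "\<exists>N\<^sub>0. \<forall>N\<ge>N\<^sub>0. finite {t. \<exists>y. \<forall>s\<in>S. F y s = t ^ (N ^ \<sigma> s)}" if "F \<in> \<F>" for F
  proof -
    obtain s0 where s0: "s0 \<in> S" and *: "\<And>s. s\<in>S \<Longrightarrow> (\<lambda>y. F y s) \<in> poly_functions (S - {s0})"
      using F[OF \<open>F \<in> \<F>\<close>] by blast
    have proper: "S - {s0} \<subset> S" using s0 by auto
    show ?thesis by (rule curve_meets_image_finitely[OF S proper \<sigma> *])
  qed
  then have "\<exists>N\<^sub>0. \<forall>F\<in>\<F>. \<forall>N\<ge>N\<^sub>0 F. finite {t. \<exists>y. \<forall>s\<in>S. F y s = t ^ (N ^ \<sigma> s)}"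
    by (intro bchoice) blast
  then obtain N0 where N0: "\<And>F N. F \<in> \<F> \<Longrightarrow> N \<ge> N0 F \<Longrightarrow>
      finite {t. \<exists>y. \<forall>s\<in>S. F y s = t ^ (N ^ \<sigma> s)}" by blast
  define N where "N = (\<Sum>F\<in>\<F>. N0 F)"
  have "N0 F \<le> N" if "F \<in> \<F>" for F
    unfolding N_def using \<F> that by (intro member_le_sum) auto
  then have "finite (\<Union>F\<in>\<F>. {t. \<exists>y. \<forall>s\<in>S. F y s = t ^ (N ^ \<sigma> s)})"
    using \<F> N0 by blast
  then obtain t where t: "t \<notin> (\<Union>F\<in>\<F>. {t. \<exists>y. \<forall>s\<in>S. F y s = t ^ (N ^ \<sigma> s)})"
    using infinite_UNIV_alg_closed_field ex_new_if_finite by blast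
  show thesis
  proof (rule that[of "\<lambda>s. if s \<in> S then t ^ (N ^ \<sigma> s) else b s"])
    show "\<exists>s\<in>S. F y s \<noteq> (if s \<in> S then t ^ (N ^ \<sigma> s) else b s)" if "F \<in> \<F>" for F y
      using t that by simp
  qed simp
qed


section \<open>Transversality and independent gradients\<close>

lemma (in vector_space) dim_kernel_of_functional:
  fixes \<phi> :: "'b \<Rightarrow> 'a"
  assumes W: "subspace W" "W \<subseteq> span T" "finite T"
    and add: "\<And>x y. \<phi> (x + y) = \<phi> x + \<phi> y" and scale: "\<And>a x. \<phi> (scale a x) = a * \<phi> x"
    and v: "v \<in> W" "\<phi> v \<noteq> 0"
  shows "dim W = dim (W \<inter> {x. \<phi> x = 0}) + 1"
proof -
  let ?K = "W \<inter> {x. \<phi> x = 0}"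
  have "\<phi> 0 = 0" using scale[of 0 0] by simp
  then have K: "subspace ?K"
    using W(1) by (auto simp: subspace_def add scale)
  obtain B where B: "B \<subseteq> ?K" "independent B" "?K \<subseteq> span B" "card B = dim ?K"
    by (rule basis_exists)
  have fin: "finite B"
    using independent_span_bound[OF W(3) B(2)] B(1) W(2) by auto
  have "span B \<subseteq> ?K" using B(1) K by (rule span_minimal)
  then have nin: "v \<notin> span B" using v by auto
  have "W \<subseteq> span (insert v B)"
  proof
    fix w assume w: "w \<in> W"
    have "w - scale (\<phi> w / \<phi> v) v \<in> W"
      using W(1) w v(1) by (intro subspace_diff subspace_scale)
    moreover have "\<phi> (w - scale (\<phi> w / \<phi> v) v) + \<phi> (scale (\<phi> w / \<phi> v) v) = \<phi> w"
      by (simp flip: add)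
    ultimately have "w - scale (\<phi> w / \<phi> v) v \<in> ?K" using v(2) by (simp add: scale)
    then show "w \<in> span (insert v B)" using B(3) span_breakdown_eq by blast
  qed
  moreover have "insert v B \<subseteq> W" using B(1) v(1) by auto
  moreover have "independent (insert v B)" using nin B(2) by (rule independent_insertI)
  moreover have "card (insert v B) = dim ?K + 1"
    using fin nin span_base[of v B] B(4) by (metis Suc_eq_plus1 card_insert_disjoint)
  ultimately show ?thesis by (intro dim_unique)
qed

lemma fun_scale_eq: "fun_scale = (\<lambda>c v i. c * v i)"
  by (intro ext) (simp add: fun_scale_def)

definition pairing :: "nat \<Rightarrow> (nat \<Rightarrow> 'a::field) \<Rightarrow> (nat \<Rightarrow> 'a) \<Rightarrow> 'a" where
  "pairing n g v = (\<Sum>a\<le>n. g a * v a)"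

lemma pairing_add: "pairing n g (v + w) = pairing n g v + pairing n g w"
  by (simp add: pairing_def sum.distrib algebra_simps)

lemma pairing_diff: "pairing n g (\<lambda>b. v b - w b) = pairing n g v - pairing n g w"
  by (simp add: pairing_def sum_subtractf algebra_simps)

lemma pairing_scale: "pairing n g (\<lambda>b. c * v b) = c * pairing n g v"
  by (simp add: pairing_def sum_distrib_left algebra_simps)

lemma pairing_sum: "pairing n g (\<lambda>b. \<Sum>i\<in>I. v i b) = (\<Sum>i\<in>I. pairing n g (v i))"
  unfolding pairing_def sum_distrib_left by (rule sum.swap)

lemma pairing_unit: "a \<le> n \<Longrightarrow> pairing n g (\<lambda>b. if b = a then 1 else 0) = g a"
  by (simp add: pairing_def if_distrib[of "\<lambda>x. _ * x"] cong: if_cong)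

text \<open>
  The spanning set gives the finite upper bound that \<open>dim_kernel_of_functional\<close> asks for.
\<close>

lemma coord_space_span_and_dim:
  "coord_space n \<subseteq> fun_vs.span ((\<lambda>i k. if k = i then 1 else 0 :: 'a::field) ` {..n})"
  "fun_vs.dim (coord_space n :: (nat \<Rightarrow> 'a) set) = n + 1"
proof -
  let ?e = "\<lambda>i k. if k = i then 1 else 0 :: 'a"
  define V where "V m = {v :: nat \<Rightarrow> 'a. \<forall>i\<ge>m. v i = 0}" for m
  have sub: "fun_vs.subspace (V m)" for m
    by (auto simp: V_def fun_vs.subspace_def)
  have span: "V m \<subseteq> fun_vs.span (?e ` {..<m})" for m
  proof
    fix v assume v: "v \<in> V m"
    have "(\<Sum>i<m. (\<lambda>k. v i * ?e i k)) k = (\<Sum>i<m. v i * ?e i k)" for k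
      by (induction m) auto
    also have "(\<Sum>i<m. v i * ?e i k) = v k" for k
      using v by (simp add: V_def if_distrib[of "\<lambda>x. _ * x"] cong: if_cong)
    finally have "v = (\<Sum>i<m. (\<lambda>k. v i * ?e i k))" by (intro ext) simp
    also have "\<dots> \<in> fun_vs.span (?e ` {..<m})"
      by (intro fun_vs.span_sum fun_vs.span_scale fun_vs.span_base) auto
    finally show "v \<in> fun_vs.span (?e ` {..<m})" .
  qed
  have dim: "fun_vs.dim (V m) = m" for m
  proof (induction m)
    case 0
    have "V 0 = {0}" by (auto simp: V_def)
    moreover have "fun_vs.dim {0 :: nat \<Rightarrow> 'a} = 0"
      using fun_vs.independent_empty by (intro fun_vs.dim_unique[of "{}"]) auto
    ultimately show ?case by simp
  next
    case (Suc m)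
    have "fun_vs.dim (V (Suc m)) = fun_vs.dim (V (Suc m) \<inter> {v. v m = 0}) + 1"
      by (rule fun_vs.dim_kernel_of_functional[OF sub span, where v = "?e m"]) (auto simp: V_def)
    also have "V (Suc m) \<inter> {v. v m = 0} = V m"
      unfolding V_def by (auto simp: not_less_eq_eq) (metis le_antisym not_less_eq_eq)
    finally show ?case using Suc by simp
  qed
  have V: "coord_space n = V (Suc n)" by (auto simp: V_def coord_space_def Suc_le_eq)
  show "coord_space n \<subseteq> fun_vs.span (?e ` {..n})" using span[of "Suc n"] by (simp add: V lessThan_Suc_atMost)
  show "fun_vs.dim (coord_space n :: (nat \<Rightarrow> 'a) set) = n + 1" using dim by (simp add: V)
qed

lemma subspace_common_kernel:
  fixes g :: "'i \<Rightarrow> nat \<Rightarrow> 'a::field"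
  shows
  "fun_vs.subspace {v \<in> coord_space n. \<forall>i\<in>I. pairing n (g i) v = 0}"
proof -
  have "pairing n g (0 :: nat \<Rightarrow> 'a) = 0" for g :: "nat \<Rightarrow> 'a" by (simp add: pairing_def)
  then show ?thesis
    by (simp add: fun_vs.subspace_def coord_space_def pairing_add pairing_scale)
qed

text \<open>
  Gaussian elimination. The functional \<open>g k\<close>, corrected so that it vanishes on the dual vectors found
  before, is nonzero by independence; a unit vector on which it does not vanish yields the new dual
  vector.
\<close>

lemma dual_vectors_exist:
  fixes g :: "'i \<Rightarrow> nat \<Rightarrow> 'a::field"
  assumes "finite I"
    and "\<And>l. (\<And>a. a \<le> n \<Longrightarrow> (\<Sum>i\<in>I. l i * g i a) = 0) \<Longrightarrow> \<forall>i\<in>I. l i = 0"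
  shows "\<exists>w. \<forall>i\<in>I. w i \<in> coord_space n \<and>
           (\<forall>j\<in>I. pairing n (g j) (w i) = (if i = j then 1 else 0))"
  using assms
proof (induction I)
  case empty
  show ?case by simp
next
  case (insert k I)
  have indep: "\<forall>i\<in>I. l i = 0" if l: "\<And>a. a \<le> n \<Longrightarrow> (\<Sum>i\<in>I. l i * g i a) = 0" for l
  proof -
    have "\<forall>i\<in>insert k I. (if i = k then 0 else l i) = 0"
    proof (rule insert.prems)
      fix a assume "a \<le> n"
      have "(\<Sum>i\<in>I. (if i = k then 0 else l i) * g i a) = (\<Sum>i\<in>I. l i * g i a)"
        using insert.hyps(2) by (intro sum.cong) auto
      then show "(\<Sum>i\<in>insert k I. (if i = k then 0 else l i) * g i a) = 0"
        using insert.hyps l[OF \<open>a \<le> n\<close>] by simp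
    qed
    then show ?thesis using insert.hyps(2) by (metis insertCI)
  qed
  obtain w where w: "\<And>i. i \<in> I \<Longrightarrow> w i \<in> coord_space n"
    and dual: "\<And>i j. i \<in> I \<Longrightarrow> j \<in> I \<Longrightarrow> pairing n (g j) (w i) = (if i = j then 1 else 0)"
    using insert.IH[OF indep] by blast
  define \<psi> where "\<psi> = (\<lambda>a. g k a - (\<Sum>i\<in>I. pairing n (g k) (w i) * g i a))"
  have "\<exists>a\<le>n. \<psi> a \<noteq> 0"
  proof (rule ccontr)
    assume "\<not> ?thesis"
    then have \<psi>: "\<psi> a = 0" if "a \<le> n" for a using that by blast
    have "\<forall>i\<in>insert k I. (if i = k then 1 else - pairing n (g k) (w i)) = 0"
    proof (rule insert.prems)
      fix a assume "a \<le> n"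
      have "(\<Sum>i\<in>I. (if i = k then 1 else - pairing n (g k) (w i)) * g i a)
          = - (\<Sum>i\<in>I. pairing n (g k) (w i) * g i a)"
        unfolding sum_negf[symmetric] using insert.hyps(2) by (intro sum.cong) auto
      then show "(\<Sum>i\<in>insert k I. (if i = k then 1 else - pairing n (g k) (w i)) * g i a) = 0"
        using insert.hyps \<psi>[OF \<open>a \<le> n\<close>] by (simp add: \<psi>_def)
    qed
    then show False by auto
  qed
  then obtain a where a: "a \<le> n" "\<psi> a \<noteq> 0" by blast
  define u where "u = (\<lambda>b. (if b = a then 1 else 0) - (\<Sum>i\<in>I. g i a * w i b))"
  have pair_u: "pairing n h u = h a - (\<Sum>i\<in>I. g i a * pairing n h (w i))" for h
    unfolding u_def using a(1) by (simp add: pairing_diff pairing_sum pairing_scale pairing_unit)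
  have u: "u \<in> coord_space n" using w a(1) by (auto simp: u_def coord_space_def)
  have u_k: "pairing n (g k) u = \<psi> a" by (simp add: pair_u \<psi>_def mult.commute)
  have u_I: "pairing n (g j) u = 0" if "j \<in> I" for j
    using that insert.hyps(1) dual
    by (simp add: pair_u if_distrib[of "\<lambda>x. _ * x"] cong: if_cong)
  define v where "v = (\<lambda>b. (1 / \<psi> a) * u b)"
  define w' where "w' = (\<lambda>i. if i = k then v else (\<lambda>b. w i b - pairing n (g k) (w i) * v b))"
  have "w' i \<in> coord_space n" if "i \<in> insert k I" for i
    using that w u by (auto simp: w'_def v_def coord_space_def)
  moreover have "pairing n (g j) (w' i) = (if i = j then 1 else 0)"
    if "i \<in> insert k I" "j \<in> insert k I" for i j
  proof -
    have v: "pairing n (g k) v = 1" "\<And>j. j \<in> I \<Longrightarrow> pairing n (g j) v = 0"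
      unfolding v_def pairing_scale using a(2) u_k u_I by simp_all
    show ?thesis
      using that dual v insert.hyps(2) by (auto simp: w'_def pairing_diff pairing_scale)
  qed
  ultimately show ?case by blast
qed

text \<open>
  Each dual vector lies in the common kernel of the other functionals, so that every further functional
  lowers the dimension by one.
\<close>

lemma dim_common_kernel:
  fixes g :: "'i \<Rightarrow> nat \<Rightarrow> 'a::field"
  assumes "finite I"
    and "\<And>i. i \<in> I \<Longrightarrow> w i \<in> coord_space n"
    and "\<And>i j. i \<in> I \<Longrightarrow> j \<in> I \<Longrightarrow> pairing n (g j) (w i) = (if i = j then 1 else 0)"
  shows "fun_vs.dim {v \<in> coord_space n. \<forall>i\<in>I. pairing n (g i) v = 0} + card I = n + 1"
  using assms
proof (induction I)
  case empty
  show ?case by (simp add: coord_space_span_and_dim(2))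
next
  case (insert k I)
  let ?W = "{v \<in> coord_space n. \<forall>i\<in>I. pairing n (g i) v = 0}"
  have "fun_vs.dim ?W = fun_vs.dim (?W \<inter> {v. pairing n (g k) v = 0}) + 1"
  proof (rule fun_vs.dim_kernel_of_functional[OF subspace_common_kernel _ _ pairing_add, where v = "w k"])
    show "?W \<subseteq> fun_vs.span ((\<lambda>i k. if k = i then 1 else 0) ` {..n})"
      using coord_space_span_and_dim(1) by blast
    show "w k \<in> ?W" using insert.prems insert.hyps(2) by auto
    show "pairing n (g k) (w k) \<noteq> 0" using insert.prems by simp
  qed (auto simp: pairing_scale)
  moreover have "?W \<inter> {v. pairing n (g k) v = 0}
      = {v \<in> coord_space n. \<forall>i\<in>insert k I. pairing n (g i) v = 0}" by auto
  moreover have "fun_vs.dim ?W + card I = n + 1"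
    using insert.prems by (intro insert.IH) auto
  ultimately show ?case using insert.hyps by simp
qed

text \<open>
  The multipliers \<open>l\<close> run over all of \<open>J\<close>, and only those equations whose multiplier does not vanish
  have to hold at the point. This treats all subsets of \<open>J\<close> at once: the subset is the support of \<open>l\<close>.
\<close>

definition independent_gradients :: "nat \<Rightarrow> 'i set \<Rightarrow> ('i \<Rightarrow> 'a::field mpol) \<Rightarrow> bool" where
  "independent_gradients n J D \<longleftrightarrow>
     (\<forall>p\<in>hom_coords n. \<forall>l. (\<forall>i\<in>J. l i \<noteq> 0 \<longrightarrow> mpol_eval (D i) p = 0) \<and>
        (\<forall>a\<le>n. (\<Sum>i\<in>J. l i * mpol_eval (mpol_pderiv a (D i)) p) = 0) \<longrightarrow> (\<forall>i\<in>J. l i = 0))"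

lemma independent_gradientsD:
  fixes D :: "'i \<Rightarrow> 'a::field mpol"
  assumes "independent_gradients n J D" "p \<in> hom_coords n"
    and "\<And>i. i \<in> J \<Longrightarrow> l i \<noteq> 0 \<Longrightarrow> mpol_eval (D i) p = 0"
    and "\<And>a. a \<le> n \<Longrightarrow> (\<Sum>i\<in>J. l i * mpol_eval (mpol_pderiv a (D i)) p) = 0"
    and "i \<in> J"
  shows "l i = 0"
proof -
  have "(\<forall>i\<in>J. l i \<noteq> 0 \<longrightarrow> mpol_eval (D i) p = 0) \<and>
      (\<forall>a\<le>n. (\<Sum>i\<in>J. l i * mpol_eval (mpol_pderiv a (D i)) p) = 0) \<longrightarrow> (\<forall>i\<in>J. l i = 0)"
    by (rule bspec[OF assms(1)[unfolded independent_gradients_def] assms(2), THEN spec[of _ l]])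
  then show ?thesis using assms(3-5) by simp
qed

lemma independent_gradients_imp_nonsingular:
  fixes D :: "'i \<Rightarrow> 'a::field mpol"
  assumes "independent_gradients n J D" "finite J" "k \<in> J"
  shows "nonsingular_hypersurface n (D k)"
  unfolding nonsingular_hypersurface_def
proof (intro ballI impI, rule ccontr)
  fix p assume p: "p \<in> hom_coords n" "mpol_eval (D k) p = 0"
    and "\<not> (\<exists>i\<le>n. mpol_eval (mpol_pderiv i (D k)) p \<noteq> 0)"
  then have "(\<Sum>i\<in>J. (if i = k then 1 else 0) * mpol_eval (mpol_pderiv a (D i)) p) = 0"
    if "a \<le> n" for a
    using that by (intro sum.neutral) auto
  then have "(if k = k then 1 else 0) = (0::'a)"
    using p assms(3)
    by (intro independent_gradientsD[OF assms(1) p(1), of "\<lambda>i. if i = k then 1 else 0"])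
      (auto split: if_splits)
  then show False by simp
qed

lemma independent_gradients_imp_transversal:
  fixes D :: "'i \<Rightarrow> 'a::field mpol"
  assumes ind: "independent_gradients n J D" and J: "finite J" "card J \<le> n"
  shows "intersect_transversally n J D"
  unfolding intersect_transversally_def
proof (intro allI impI ballI)
  fix I and p :: "nat \<Rightarrow> 'a"
  assume I: "I \<subseteq> J" and p: "p \<in> hom_coords n" and zero: "\<forall>i\<in>I. mpol_eval (D i) p = 0"
  define g where "g = (\<lambda>i a. mpol_eval (mpol_pderiv a (D i)) p)"
  have fin: "finite I" using I J(1) by (rule finite_subset)
  have "\<forall>i\<in>I. l i = 0" if l: "\<And>a. a \<le> n \<Longrightarrow> (\<Sum>i\<in>I. l i * g i a) = 0" for l
  proof -
    have "(\<Sum>i\<in>J. (if i \<in> I then l i else 0) * g i a) = 0" if "a \<le> n" for a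
    proof -
      have "(\<Sum>i\<in>J. (if i \<in> I then l i else 0) * g i a) = (\<Sum>i\<in>I. l i * g i a)"
        using I J(1) by (intro sum.mono_neutral_cong_right) auto
      with l[OF that] show ?thesis by simp
    qed
    then have "(if i \<in> I then l i else 0) = 0" if "i \<in> J" for i
      using zero that
      by (intro independent_gradientsD[OF ind p, of "\<lambda>i. if i \<in> I then l i else 0"])
        (auto simp: g_def split: if_splits)
    then show ?thesis using I by (metis subsetD)
  qed
  from dual_vectors_exist[OF fin this] obtain w where
    "\<And>i. i \<in> I \<Longrightarrow> w i \<in> coord_space n"
    "\<And>i j. i \<in> I \<Longrightarrow> j \<in> I \<Longrightarrow> pairing n (g j) (w i) = (if i = j then 1 else 0)"
    by blast
  from dim_common_kernel[OF fin this]
  have "fun_vs.dim {v \<in> coord_space n. \<forall>i\<in>I. pairing n (g i) v = 0} + card I = n + 1" .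
  also have "{v \<in> coord_space n. \<forall>i\<in>I. pairing n (g i) v = 0}
      = coord_space n \<inter> (\<Inter>i\<in>I. proj_tangent n (D i) p)"
    by (auto simp: pairing_def g_def proj_tangent_def)
  finally have dim: "fun_vs.dim (coord_space n \<inter> (\<Inter>i\<in>I. proj_tangent n (D i) p)) + card I = n + 1" .
  have "card I \<le> n" using card_mono[OF J(1) I] J(2) by simp
  moreover have "fun_vs.dim {p} = 1"
    using p fun_vs.dim_eq_card_independent[of "{p}"]
    by (auto simp: hom_coords_def zero_fun_def)
  ultimately show "quot_dim p (coord_space n \<inter> (\<Inter>i\<in>I. proj_tangent n (D i) p)) + card I
      = quot_dim p (coord_space n)"
    using dim by (simp add: quot_dim_def fun_scale_eq coord_space_span_and_dim(2))
qed


section \<open>Forms spanned by products of a power and a variable\<close>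

lemma mpol_subst_superset:
  assumes "h 0 = 0" "finite A" "Poly_Mapping.keys Q \<subseteq> A"
  shows "mpol_subst h Q x = (\<Sum>m\<in>A. h (Poly_Mapping.lookup Q m) *
    (\<Prod>i\<in>Poly_Mapping.keys m. x i ^ Poly_Mapping.lookup m i))"
  unfolding mpol_subst_def
  by (rule sum.mono_neutral_left) (use assms in \<open>auto simp: in_keys_iff\<close>)

lemma mpol_subst_add:
  assumes "h 0 = 0" "\<And>a b. h (a + b) = h a + h b"
  shows "mpol_subst h (P + Q) x = mpol_subst h P x + mpol_subst h Q x"
proof -
  let ?A = "Poly_Mapping.keys P \<union> Poly_Mapping.keys Q"
  have "Poly_Mapping.keys (P + Q) \<subseteq> ?A" by (rule keys_add)
  then show ?thesis
    by (simp add: mpol_subst_superset[where A = ?A] assms lookup_add distrib_right sum.distrib)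
qed

lemma mpol_subst_zero: "mpol_subst h 0 x = 0"
  by (simp add: mpol_subst_def)

lemma mpol_subst_sum:
  assumes "h 0 = 0" "\<And>a b. h (a + b) = h a + h b"
  shows "mpol_subst h (\<Sum>i\<in>A. P i) x = (\<Sum>i\<in>A. mpol_subst h (P i) x)"
  by (induction A rule: infinite_finite_induct) (auto simp: mpol_subst_add mpol_subst_zero assms)

lemma mpol_subst_single:
  assumes "h 0 = 0"
  shows "mpol_subst h (Poly_Mapping.single m c) x =
    h c * (\<Prod>i\<in>Poly_Mapping.keys m. x i ^ Poly_Mapping.lookup m i)"
  by (subst mpol_subst_superset[where A = "{m}"]) (use assms in auto)

lemma mpol_pderiv_superset:
  assumes "finite A" "Poly_Mapping.keys Q \<subseteq> A"
  shows "mpol_pderiv a Q = (\<Sum>m\<in>A. Poly_Mapping.single (m - Poly_Mapping.single a 1)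
    (of_nat (Poly_Mapping.lookup m a) * Poly_Mapping.lookup Q m))"
  unfolding mpol_pderiv_def
  by (rule sum.mono_neutral_left) (use assms in \<open>auto simp: in_keys_iff\<close>)

lemma mpol_pderiv_add: "mpol_pderiv a (P + Q) = mpol_pderiv a P + mpol_pderiv a Q"
proof -
  let ?A = "Poly_Mapping.keys P \<union> Poly_Mapping.keys Q"
  have "Poly_Mapping.keys (P + Q) \<subseteq> ?A" by (rule keys_add)
  then show ?thesis
    by (simp add: mpol_pderiv_superset[where A = ?A] lookup_add distrib_left single_add sum.distrib)
qed

lemma mpol_pderiv_sum: "mpol_pderiv a (\<Sum>i\<in>A. P i) = (\<Sum>i\<in>A. mpol_pderiv a (P i))"
proof -
  have "mpol_pderiv a 0 = 0" by (simp add: mpol_pderiv_def)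
  then show ?thesis
    by (induction A rule: infinite_finite_induct) (auto simp: mpol_pderiv_add)
qed

lemma mpol_pderiv_single:
  "mpol_pderiv a (Poly_Mapping.single m c) =
    Poly_Mapping.single (m - Poly_Mapping.single a 1) (of_nat (Poly_Mapping.lookup m a) * c)"
  by (subst mpol_pderiv_superset[where A = "{m}"]) auto

text \<open>
  The variables may coincide, in which case this is a pure power.
\<close>

definition two_variable_monomial :: "nat \<Rightarrow> nat \<Rightarrow> nat \<Rightarrow> nat \<Rightarrow>\<^sub>0 nat" where
  "two_variable_monomial e j l = Poly_Mapping.single j e + Poly_Mapping.single l 1"

lemma monomial_value_superset:
  assumes "finite A" "Poly_Mapping.keys m \<subseteq> A"
  shows "(\<Prod>i\<in>Poly_Mapping.keys m. x i ^ Poly_Mapping.lookup m i) =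
    (\<Prod>i\<in>A. x i ^ Poly_Mapping.lookup m i)"
  by (rule prod.mono_neutral_left) (use assms in \<open>auto simp: in_keys_iff\<close>)

lemma monomial_value_single:
  "(\<Prod>i\<in>Poly_Mapping.keys (Poly_Mapping.single j e). x i ^ Poly_Mapping.lookup (Poly_Mapping.single j e) i)
    = (x j ^ e :: 'a::comm_semiring_1)"
  by (subst monomial_value_superset[where A = "{j}"]) auto

lemma monomial_value_two_variable:
  "(\<Prod>i\<in>Poly_Mapping.keys (two_variable_monomial e j l).
      x i ^ Poly_Mapping.lookup (two_variable_monomial e j l) i) = (x j ^ e * x l :: 'a::comm_semiring_1)"
proof -
  have "Poly_Mapping.keys (two_variable_monomial e j l) \<subseteq> {j, l}"
    unfolding two_variable_monomial_def by (rule order_trans[OF keys_add]) auto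
  then show ?thesis
    by (subst monomial_value_superset[where A = "{j, l}"], simp, assumption, cases "j = l")
      (auto simp: two_variable_monomial_def lookup_add lookup_single mult.commute)
qed

lemma eval_pderiv_two_variable_monomial:
  "mpol_eval (mpol_pderiv a (Poly_Mapping.single (two_variable_monomial e j l) c)) p =
     c * ((if a = l then p j ^ e else 0) + (if a = j then of_nat e * p j ^ (e - 1) * p l else 0))"
proof -
  let ?m = "two_variable_monomial e j l"
  consider "a = l" "a = j" | "a = l" "a \<noteq> j" | "a \<noteq> l" "a = j" "e > 0" | "a \<noteq> l" "a = j" "e = 0"
    | "a \<noteq> l" "a \<noteq> j" by blast
  then show ?thesis
  proof cases
    case 1
    then have "?m - Poly_Mapping.single a 1 = Poly_Mapping.single j e"
      by (simp add: two_variable_monomial_def)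
    then show ?thesis using 1
      by (cases e) (simp_all add: mpol_pderiv_single mpol_eval_def mpol_subst_single
          monomial_value_single two_variable_monomial_def lookup_add algebra_simps)
  next
    case 2
    then have "?m - Poly_Mapping.single a 1 = Poly_Mapping.single j e"
      by (simp add: two_variable_monomial_def)
    then show ?thesis using 2
      by (simp add: mpol_pderiv_single mpol_eval_def mpol_subst_single
          monomial_value_single two_variable_monomial_def lookup_add lookup_single)
  next
    case 3
    then have "?m - Poly_Mapping.single a 1 = two_variable_monomial (e - 1) j l"
      by (intro poly_mapping_eqI)
        (auto simp: two_variable_monomial_def lookup_add lookup_minus lookup_single when_def)
    moreover have "Poly_Mapping.lookup ?m a = e"
      using 3 by (simp add: two_variable_monomial_def lookup_add lookup_single)
    ultimately show ?thesis using 3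
      by (simp add: mpol_pderiv_single mpol_eval_def mpol_subst_single
          monomial_value_two_variable algebra_simps)
  next
    case 4
    then show ?thesis
      by (simp add: mpol_subst_zero mpol_pderiv_single mpol_eval_def mpol_subst_single
          two_variable_monomial_def lookup_add lookup_single)
  next
    case 5
    then show ?thesis
      by (simp add: mpol_subst_zero mpol_pderiv_single mpol_eval_def mpol_subst_single
          two_variable_monomial_def lookup_add lookup_single)
  qed
qed

text \<open>
  At a point with \<open>x\<^sub>j \<noteq> 0\<close>, the forms \<open>x\<^sub>j\<^sup>d\<^sup>-\<^sup>1 x\<^sub>l\<close> alone realize any value together with any
  derivatives with respect to the variables other than \<open>x\<^sub>j\<close>. For \<open>d = 2\<close> the pairs
  \<open>(j, l)\<close> and \<open>(l, j)\<close> give the same monomial and their coefficients add up.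
\<close>

definition near_power_form :: "nat \<Rightarrow> nat \<Rightarrow> (nat \<Rightarrow> nat \<Rightarrow> 'a) \<Rightarrow> 'a::field mpol" where
  "near_power_form n d C =
     (\<Sum>j\<le>n. \<Sum>l\<le>n. Poly_Mapping.single (two_variable_monomial (d - 1) j l) (C j l))"

definition form_value :: "nat \<Rightarrow> nat \<Rightarrow> (nat \<Rightarrow> nat \<Rightarrow> 'a::field) \<Rightarrow> (nat \<Rightarrow> 'a) \<Rightarrow> 'a" where
  "form_value n d C p = (\<Sum>j\<le>n. \<Sum>l\<le>n. C j l * (p j ^ (d - 1) * p l))"

definition form_gradient :: "nat \<Rightarrow> nat \<Rightarrow> (nat \<Rightarrow> nat \<Rightarrow> 'a::field) \<Rightarrow> (nat \<Rightarrow> 'a) \<Rightarrow> nat \<Rightarrow> 'a" where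
  "form_gradient n d C p a = (\<Sum>j\<le>n. \<Sum>l\<le>n. C j l *
     ((if a = l then p j ^ (d - 1) else 0) + (if a = j then of_nat (d - 1) * p j ^ (d - 2) * p l else 0)))"

lemma eval_near_power_form: "mpol_eval (near_power_form n d C) p = form_value n d C p"
  by (simp add: near_power_form_def form_value_def mpol_eval_def mpol_subst_sum mpol_subst_single
      monomial_value_two_variable)

lemma eval_pderiv_near_power_form:
  "mpol_eval (mpol_pderiv a (near_power_form n d C)) p = form_gradient n d C p a"
proof -
  have sum: "mpol_eval (\<Sum>i\<in>A. P i) p = (\<Sum>i\<in>A. mpol_eval (P i) p)"
    for A and P :: "nat \<Rightarrow> 'a mpol"
    by (simp add: mpol_eval_def mpol_subst_sum)
  have eq: "d - 2 = d - 1 - 1" by simp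
  show ?thesis
    unfolding form_gradient_def eq
    by (simp add: near_power_form_def mpol_pderiv_sum sum
        eval_pderiv_two_variable_monomial) (simp only: One_nat_def)
qed

lemma homogeneous_near_power_form:
  assumes "d \<ge> 1"
  shows "homogeneous_mpol n d (near_power_form n d C)"
  unfolding homogeneous_mpol_def
proof
  fix m assume mem: "m \<in> Poly_Mapping.keys (near_power_form n d C)"
  obtain j where j: "j \<le> n" "m \<in> Poly_Mapping.keys
      (\<Sum>l\<le>n. Poly_Mapping.single (two_variable_monomial (d - 1) j l) (C j l))"
    using subsetD[OF keys_sum mem[unfolded near_power_form_def]] by blast
  from subsetD[OF keys_sum this(2)] obtain l where "l \<le> n" "m \<in> Poly_Mapping.keys
      (Poly_Mapping.single (two_variable_monomial (d - 1) j l) (C j l))"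
    by blast
  with j(1) have jl: "j \<le> n" "l \<le> n" and m: "m = two_variable_monomial (d - 1) j l"
    by (auto split: if_splits)
  have "Poly_Mapping.keys m \<subseteq> {j, l}"
    unfolding m two_variable_monomial_def by (rule order_trans[OF keys_add]) auto
  then have "Poly_Mapping.keys m \<subseteq> {..n}" using jl by auto
  moreover have "(\<Sum>i\<le>n. Poly_Mapping.lookup m i) = d"
    using jl assms by (simp add: m two_variable_monomial_def lookup_add lookup_single sum.distrib
        when_def)
  ultimately show "Poly_Mapping.keys m \<subseteq> {..n} \<and> (\<Sum>i\<le>n. Poly_Mapping.lookup m i) = d" ..
qed

lemma poly_functions_form_value:
  assumes "\<And>j l. j \<le> n \<Longrightarrow> l \<le> n \<Longrightarrow> (\<lambda>y. C y j l) \<in> poly_functions X"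
    and "\<And>l. l \<le> n \<Longrightarrow> (\<lambda>y. p y l) \<in> poly_functions X"
  shows "(\<lambda>y. form_value n d (C y) (p y)) \<in> poly_functions X"
  unfolding form_value_def by (intro poly_functions_intros assms) auto

lemma poly_functions_form_gradient:
  assumes "\<And>j l. j \<le> n \<Longrightarrow> l \<le> n \<Longrightarrow> (\<lambda>y. C y j l) \<in> poly_functions X"
    and "\<And>l. l \<le> n \<Longrightarrow> (\<lambda>y. p y l) \<in> poly_functions X"
  shows "(\<lambda>y. form_gradient n d (C y) (p y) a) \<in> poly_functions X"
  unfolding form_gradient_def by (intro poly_functions_intros assms) auto

definition clear_row :: "nat \<Rightarrow> (nat \<Rightarrow> nat \<Rightarrow> 'a::zero) \<Rightarrow> nat \<Rightarrow> nat \<Rightarrow> 'a" where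
  "clear_row j C = (\<lambda>j' l. if j' = j then 0 else C j' l)"

text \<open>
  Where \<open>p j = 1\<close>, row \<open>j\<close> of the coefficients enters the value and, by \<open>form_gradient_row\<close>, the
  derivatives with respect to the other variables linearly and without denominators. This makes the
  equations for a degenerate point solvable by polynomials.
\<close>

lemma form_value_row:
  assumes "j \<le> n" "p j = 1"
  shows "form_value n d C p = form_value n d (clear_row j C) p + (\<Sum>l\<le>n. C j l * p l)"
proof -
  have "form_value n d C p = (\<Sum>l\<le>n. C j l * p l)
      + (\<Sum>j'\<in>{..n} - {j}. \<Sum>l\<le>n. C j' l * (p j' ^ (d - 1) * p l))"
    unfolding form_value_def using assms by (subst sum.remove[of _ j]) auto
  moreover have "form_value n d (clear_row j C) p
      = (\<Sum>j'\<in>{..n} - {j}. \<Sum>l\<le>n. C j' l * (p j' ^ (d - 1) * p l))"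
    unfolding form_value_def using assms
    by (subst sum.remove[of _ j]) (auto simp: clear_row_def)
  ultimately show ?thesis by simp
qed

lemma form_gradient_row:
  assumes "j \<le> n" "a \<le> n" "a \<noteq> j" "p j = 1"
  shows "form_gradient n d C p a = form_gradient n d (clear_row j C) p a + C j a"
proof -
  let ?t = "\<lambda>j' l. (if a = l then p j' ^ (d - 1) else 0)
    + (if a = j' then of_nat (d - 1) * p j' ^ (d - 2) * p l else 0)"
  have "form_gradient n d C p a = (\<Sum>l\<le>n. C j l * ?t j l) + (\<Sum>j'\<in>{..n} - {j}. \<Sum>l\<le>n. C j' l * ?t j' l)"
    unfolding form_gradient_def using assms by (subst sum.remove[of _ j]) auto
  moreover have "(\<Sum>l\<le>n. C j l * ?t j l) = C j a"
    using assms by (simp add: if_distrib[of "\<lambda>x. _ * x"] cong: if_cong)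
  moreover have "form_gradient n d (clear_row j C) p a
      = (\<Sum>j'\<in>{..n} - {j}. \<Sum>l\<le>n. C j' l * ?t j' l)"
    unfolding form_gradient_def using assms
    by (subst sum.remove[of _ j]) (auto simp: clear_row_def)
  ultimately show ?thesis by simp
qed

lemma form_value_scale:
  assumes "d \<ge> 1"
  shows "form_value n d C (\<lambda>i. t * p i) = t ^ d * form_value n d C p"
proof -
  have "t ^ d = t ^ (d - 1) * t" using assms by (cases d) auto
  then show ?thesis
    unfolding form_value_def sum_distrib_left
    by (intro sum.cong refl) (simp add: power_mult_distrib)
qed

lemma form_gradient_scale:
  assumes "d \<ge> 2"
  shows "form_gradient n d C (\<lambda>i. t * p i) a = t ^ (d - 1) * form_gradient n d C p a"
proof -
  obtain e where "d = e + 2" using assms by (metis add.commute le_Suc_ex)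
  then have "t ^ (d - 1) = t ^ (d - 2) * t" by simp
  then show ?thesis
    unfolding form_gradient_def sum_distrib_left
    by (intro sum.cong refl) (simp add: power_mult_distrib distrib_left)
qed

text \<open>
  The derivative of \<open>x\<^sub>a\<^sup>d\<^sup>-\<^sup>1 x\<^sub>0\<close> at \<open>(1 : 0 : \<dots> : 0)\<close> contributes only when \<open>x\<^sub>a\<close> occurs to the first
  power, that is for \<open>d = 2\<close>.
\<close>

lemma form_gradient_base_point:
  assumes "d \<ge> 2" "1 \<le> a" "a \<le> n" "p 0 = 1" "\<And>l. l \<noteq> 0 \<Longrightarrow> p l = 0"
  shows "form_gradient n d C p a = C 0 a + (if d = 2 then C a 0 else 0)"
proof -
  have "form_gradient n d C p a
      = (\<Sum>j\<le>n. \<Sum>l\<le>n. (if a = l then C j l * p j ^ (d - 1) else 0))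
        + (\<Sum>j\<le>n. \<Sum>l\<le>n. (if a = j then C j l * (of_nat (d - 1) * p j ^ (d - 2) * p l) else 0))"
    unfolding form_gradient_def sum.distrib[symmetric]
    by (intro sum.cong refl) (simp add: distrib_left)
  also have "(\<Sum>j\<le>n. \<Sum>l\<le>n. (if a = l then C j l * p j ^ (d - 1) else 0))
      = (\<Sum>j\<le>n. C j a * p j ^ (d - 1))"
    using assms(3) by simp
  also have "\<dots> = (\<Sum>j\<le>n. if j = 0 then C 0 a else 0)"
    using assms(1,4,5) by (intro sum.cong refl) (auto simp: power_0_left)
  also have "(\<Sum>j\<le>n. \<Sum>l\<le>n. (if a = j then C j l * (of_nat (d - 1) * p j ^ (d - 2) * p l) else 0))
      = (\<Sum>l\<le>n. \<Sum>j\<le>n. (if a = j then C j l * (of_nat (d - 1) * p j ^ (d - 2) * p l) else 0))"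
    by (rule sum.swap)
  also have "\<dots> = (\<Sum>l\<le>n. C a l * (of_nat (d - 1) * p a ^ (d - 2) * p l))"
    using assms(3) by simp
  also have "\<dots> = (\<Sum>l\<le>n. if l = 0 then (if d = 2 then C a 0 else 0) else 0)"
    using assms(1,2,4,5) by (intro sum.cong refl) (auto simp: power_0_left)
  finally show ?thesis by simp
qed


section \<open>Analytic maps onto a line\<close>

text \<open>
  Substitution of polynomials specializes to both composition with power series and evaluation at the
  points of the curve.
\<close>

abbreviation mpol_poly :: "'a::field mpol \<Rightarrow> (nat \<Rightarrow> 'a poly) \<Rightarrow> 'a poly" where
  "mpol_poly Q q \<equiv> mpol_subst (\<lambda>a. [:a:]) Q q"

lemma mpol_compose_fps_of_poly:
  "mpol_compose Q (\<lambda>i. fps_of_poly (q i)) = fps_of_poly (mpol_poly Q q)"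
  by (simp add: mpol_compose_def mpol_subst_def fps_of_poly_sum fps_of_poly_mult fps_of_poly_prod
      fps_of_poly_power fps_of_poly_const fps_of_poly_smult)

lemma mpol_eval_poly: "mpol_eval Q (\<lambda>i. poly (q i) z) = poly (mpol_poly Q q) z"
  by (simp add: mpol_eval_def mpol_subst_def poly_sum poly_prod)

definition line_map :: "nat \<Rightarrow> 'a::field poly" where
  "line_map i = (if i = 0 then [:0, 1:] else if i = 1 then 1 else 0)"

text \<open>
  The condition on \<open>C\<close> in the case \<open>d = 1\<close> is due to \<open>0 ^ 0 = 1\<close>: there the terms with \<open>j \<ge> 2\<close> do not
  vanish on the line.
\<close>

lemma near_power_form_line_map:
  assumes "n \<ge> 1" "d \<ge> 2 \<or> (\<forall>j\<ge>2. \<forall>l. C j l = 0)" "C 0 0 = 0"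
  shows "mpol_poly (near_power_form n d C) line_map
    = monom (C 0 1) (d - 1) + [:C 1 1, C 1 0:]"
proof -
  let ?t = "\<lambda>j l. [:C j l:] * (line_map j ^ (d - 1) * line_map l)"
  have "mpol_poly (near_power_form n d C) line_map = (\<Sum>j\<le>n. \<Sum>l\<le>n. ?t j l)"
    by (simp add: near_power_form_def mpol_subst_sum mpol_subst_single
      monomial_value_two_variable)
  also have "\<dots> = (\<Sum>j\<in>{0, 1}. \<Sum>l\<le>n. ?t j l)"
  proof (rule sum.mono_neutral_right)
    show "\<forall>j\<in>{..n} - {0, 1}. (\<Sum>l\<le>n. ?t j l) = 0"
    proof
      fix j assume "j \<in> {..n} - {0, 1}"
      then have j: "j \<ge> 2" by auto
      have "?t j l = 0" for l
        using assms(2)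
      proof
        assume "d \<ge> 2"
        then show ?thesis using j by (simp add: line_map_def power_0_left)
      qed (use j in simp)
      then show "(\<Sum>l\<le>n. ?t j l) = 0" by (intro sum.neutral ballI)
    qed
  qed (use assms(1) in auto)
  also have "\<dots> = (\<Sum>j\<in>{0, 1}. \<Sum>l\<in>{0, 1}. ?t j l)"
    by (intro sum.cong refl sum.mono_neutral_right) (use assms(1) in \<open>auto simp: line_map_def\<close>)
  also have "\<dots> = monom (C 0 1) (d - 1) + [:C 1 1, C 1 0:]"
  proof -
    have "[:0, 1:] ^ k = (monom 1 k :: 'a poly)" for k
      by (simp add: monom_altdef)
    then show ?thesis using assms(3) by (simp add: line_map_def smult_monom)
  qed
  finally show ?thesis .
qed

context
  fixes av :: "'a::field \<Rightarrow> real"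
  assumes av: "nonarch_abs av"
begin

lemma av_simps: "0 \<le> av x" "av x = 0 \<longleftrightarrow> x = 0" "av (x * y) = av x * av y"
  and av_add: "av (x + y) \<le> max (av x) (av y)"
  using av by (auto simp: nonarch_abs_def)

lemma av_1: "av 1 = 1"
  using av_simps(3)[of 1 1] av_simps(2)[of 1] by simp

lemma av_uminus: "av (- x) = av x"
proof -
  have "(av (- 1) - 1) * (av (- 1) + 1) = 0"
    using av_simps(3)[of "-1" "-1"] by (simp add: av_1 algebra_simps)
  then have "av (- 1) = 1" using av_simps(1)[of "-1"] by (auto simp: add_nonneg_eq_0_iff)
  then show ?thesis using av_simps(3)[of "-1" x] by simp
qed

lemma Metric_space_abs_dist: "Metric_space UNIV (abs_dist av)"
proof
  fix x y z :: 'a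
  show "abs_dist av x y = abs_dist av y x" using av_uminus[of "x - y"] by (simp add: abs_dist_def)
  show "abs_dist av x z \<le> abs_dist av x y + abs_dist av y z"
    using av_add[of "x - y" "y - z"] av_simps(1)[of "x - y"] av_simps(1)[of "y - z"]
    by (simp add: abs_dist_def)
qed (auto simp: abs_dist_def av_simps)

lemma fps_of_poly_converges_to: "fps_converges_to av (fps_of_poly q) z (poly q z)"
proof -
  interpret Metric_space UNIV "abs_dist av" by (rule Metric_space_abs_dist)
  have "(\<Sum>i<N. coeff q i * z ^ i) = poly q z" if "N > degree q" for N
    unfolding poly_altdef
    by (rule sum.mono_neutral_right) (use that in \<open>auto simp: not_le coeff_eq_0\<close>)
  then have "eventually (\<lambda>N. (\<Sum>i<N. coeff q i * z ^ i) = poly q z) sequentially"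
    using eventually_gt_at_top[of "degree q"] by (rule eventually_mono[rotated])
  then show ?thesis
    unfolding fps_converges_to_def limitin_metric
    by (auto elim!: eventually_mono)
qed

lemma entire_fps_of_poly: "entire av (fps_of_poly q)"
  unfolding entire_def using fps_of_poly_converges_to by blast

lemma fps_value_fps_of_poly: "fps_value av (fps_of_poly q) z = poly q z"
  unfolding fps_value_def
proof (rule the_equality)
  interpret Metric_space UNIV "abs_dist av" by (rule Metric_space_abs_dist)
  fix s assume "fps_converges_to av (fps_of_poly q) z s"
  then show "s = poly q z"
    using fps_of_poly_converges_to[of q z] unfolding fps_converges_to_def
    by (rule limitin_metric_unique) simp
qed (rule fps_of_poly_converges_to)

lemma gauss_norm_fps_of_poly_bounds:
  assumes "r \<ge> 1"
  shows "av (lead_coeff q) * r ^ degree q \<le> gauss_norm av (fps_of_poly q) r"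
    and "gauss_norm av (fps_of_poly q) r \<le> (\<Sum>i\<le>degree q. av (coeff q i)) * r ^ degree q"
proof -
  let ?B = "(\<Sum>i\<le>degree q. av (coeff q i)) * r ^ degree q"
  have B: "av (coeff q i) * r ^ i \<le> ?B" for i
  proof (cases "i \<le> degree q")
    case True
    then show ?thesis
      using assms by (intro mult_mono member_le_sum power_increasing sum_nonneg)
        (auto simp: av_simps)
  next
    case False
    then have "av (coeff q i) = 0" by (simp add: av_simps coeff_eq_0)
    then show ?thesis using assms by (simp add: sum_nonneg av_simps(1))
  qed
  show "gauss_norm av (fps_of_poly q) r \<le> ?B"
    unfolding gauss_norm_def using B by (intro cSUP_least) auto
  have "bdd_above (range (\<lambda>i. av (coeff q i) * r ^ i))" using B by (rule bdd_aboveI2)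
  then show "av (lead_coeff q) * r ^ degree q \<le> gauss_norm av (fps_of_poly q) r"
    unfolding gauss_norm_def
    using cSUP_upper[of "degree q" UNIV "\<lambda>i. av (coeff q i) * r ^ i"] by simp
qed

lemma gauss_norm_fps_of_poly_pos:
  assumes "q \<noteq> 0" "r \<ge> 1"
  shows "gauss_norm av (fps_of_poly q) r > 0"
proof -
  have "0 < av (lead_coeff q)" using assms(1) av_simps(1,2)[of "lead_coeff q"] by (simp add: less_le)
  then have "0 < av (lead_coeff q) * r ^ degree q" using assms(2) by simp
  also have "\<dots> \<le> gauss_norm av (fps_of_poly q) r"
    by (rule gauss_norm_fps_of_poly_bounds(1)[OF assms(2)])
  finally show ?thesis .
qed

text \<open>
  For \<open>r \<ge> 1\<close> the Gauss norm of a polynomial is \<open>r ^ degree\<close> up to constant factors, as the leading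
  coefficient gives a lower bound, and the sum of the absolute values of all coefficients an upper bound.
\<close>

lemma ln_gauss_norm_fps_of_poly:
  assumes "q \<noteq> 0"
  shows "\<exists>C. \<forall>r\<ge>1. \<bar>ln (gauss_norm av (fps_of_poly q) r) - real (degree q) * ln r\<bar> \<le> C"
proof -
  let ?A = "av (lead_coeff q)" and ?B = "\<Sum>i\<le>degree q. av (coeff q i)"
  have A: "0 < ?A" using assms av_simps(1,2)[of "lead_coeff q"] by (simp add: less_le)
  have "?A \<le> ?B" by (intro member_le_sum) (auto simp: av_simps)
  with A have B: "0 < ?B" by simp
  have "\<bar>ln (gauss_norm av (fps_of_poly q) r) - real (degree q) * ln r\<bar> \<le> \<bar>ln ?A\<bar> + \<bar>ln ?B\<bar>"
    if r: "r \<ge> 1" for r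
  proof -
    let ?g = "gauss_norm av (fps_of_poly q) r"
    have g: "?g > 0" by (rule gauss_norm_fps_of_poly_pos[OF assms r])
    have "ln (?A * r ^ degree q) \<le> ln ?g"
      using gauss_norm_fps_of_poly_bounds(1)[OF r] A r g by (subst ln_le_cancel_iff) auto
    moreover have "ln ?g \<le> ln (?B * r ^ degree q)"
      using gauss_norm_fps_of_poly_bounds(2)[OF r] B r g by (subst ln_le_cancel_iff) auto
    ultimately show ?thesis
      using A B r by (simp add: ln_mult ln_realpow)
  qed
  then show ?thesis by blast
qed

lemma map_norm_line_map:
  assumes "n \<ge> 1" "r \<ge> 1"
  shows "map_norm av n (\<lambda>i. fps_of_poly (line_map i)) r = r"
proof -
  have X: "gauss_norm av fps_X r = r"
    using gauss_norm_fps_of_poly_bounds[OF assms(2), of "[:0, 1:]"] av_simps(2)[of 0]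
    by (simp add: av_1 order.antisym)
  have one: "gauss_norm av (fps_of_poly 1) r = 1"
    using gauss_norm_fps_of_poly_bounds[OF assms(2), of 1] by (simp add: av_1)
  have zero: "gauss_norm av (fps_of_poly 0) r = 0"
    using av_simps(2)[of 0] by (simp add: gauss_norm_def)
  show ?thesis
    unfolding map_norm_def
  proof (rule Max_eqI)
    show "r \<in> (\<lambda>i. gauss_norm av (fps_of_poly (line_map i)) r) ` {..n}"
      by (rule image_eqI[of _ _ 0]) (simp_all add: line_map_def X)
    show "y \<le> r" if "y \<in> (\<lambda>i. gauss_norm av (fps_of_poly (line_map i)) r) ` {..n}" for y
      using that assms(2) X one zero by (auto simp: line_map_def)
  qed simp
qed

lemma analytic_line_map:
  assumes "n \<ge> 1"
  shows "analytic_map av n (\<lambda>i. fps_of_poly (line_map i))"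
  unfolding analytic_map_def using assms
  by (auto simp: entire_fps_of_poly fps_value_fps_of_poly line_map_def intro!: exI[of _ 1])

lemma nonconstant_line_map:
  assumes "n \<ge> 1"
  shows "nonconstant_map av n (\<lambda>i. fps_of_poly (line_map i))"
proof -
  have "\<not> same_point n (map_value av (\<lambda>i. fps_of_poly (line_map i)) 1)
      (map_value av (\<lambda>i. fps_of_poly (line_map i)) 0)"
    using assms by (auto simp: same_point_def map_value_def fps_value_fps_of_poly line_map_def)
  then show ?thesis unfolding nonconstant_map_def by blast
qed

text \<open>
  Since \<open>T\<^sub>f(r) = log r\<close>, each proximity function is \<open>(d - deg (Q\<^sub>i \<circ> f)) log r + O(1)\<close>.
\<close>

lemma proximity_sum_line_map:
  assumes n: "n \<ge> 1" and d: "d \<ge> 1"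
    and q: "\<And>i. i \<in> {1..n} \<Longrightarrow> mpol_poly (D i) line_map \<noteq> 0"
    and deg: "(\<Sum>i=1..n. degree (mpol_poly (D i) line_map)) = d - 1"
  shows "\<exists>C. \<forall>r\<ge>1.
    \<bar>(\<Sum>i=1..n. proximity_fun av n d (\<lambda>i. fps_of_poly (line_map i)) (D i) r / real d)
      - (real n - 1 + 1 / real d) * characteristic_fun av n (\<lambda>i. fps_of_poly (line_map i)) r\<bar> \<le> C"
proof -
  let ?q = "\<lambda>i. mpol_poly (D i) line_map" and ?f = "\<lambda>i. fps_of_poly (line_map i)"
  let ?g = "\<lambda>i r. gauss_norm av (fps_of_poly (?q i)) r"
  have "\<forall>i\<in>{1..n}. \<exists>C. \<forall>r\<ge>1. \<bar>ln (?g i r) - real (degree (?q i)) * ln r\<bar> \<le> C"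
    by (intro ballI ln_gauss_norm_fps_of_poly q)
  then obtain C where C: "\<forall>i\<in>{1..n}. \<forall>r\<ge>1. \<bar>ln (?g i r) - real (degree (?q i)) * ln r\<bar> \<le> C i"
    by (rule bchoice[THEN exE])
  have "\<bar>(\<Sum>i=1..n. proximity_fun av n d ?f (D i) r / real d)
      - (real n - 1 + 1 / real d) * characteristic_fun av n ?f r\<bar> \<le> (\<Sum>i=1..n. C i) / real d"
    if r: "r \<ge> 1" for r
  proof -
    have prox: "proximity_fun av n d ?f (D i) r = real d * ln r - ln (?g i r)" if "i \<in> {1..n}" for i
      using gauss_norm_fps_of_poly_pos[OF q[OF that] r] r
      by (simp add: proximity_fun_def map_norm_line_map[OF n r] mpol_compose_fps_of_poly
          ln_div ln_realpow)
    have "(\<Sum>i=1..n. proximity_fun av n d ?f (D i) r / real d)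
        = (\<Sum>i=1..n. real d * ln r - ln (?g i r)) / real d"
      unfolding sum_divide_distrib by (intro sum.cong refl) (simp only: prox)
    also have "\<dots> = (real n * real d * ln r - (\<Sum>i=1..n. ln (?g i r))) / real d"
      by (simp add: sum_subtractf)
    finally have "(\<Sum>i=1..n. proximity_fun av n d ?f (D i) r / real d)
        - (real n - 1 + 1 / real d) * characteristic_fun av n ?f r
        = ((real d - 1) * ln r - (\<Sum>i=1..n. ln (?g i r))) / real d"
      unfolding characteristic_fun_def map_norm_line_map[OF n r]
      using d by (simp add: diff_divide_distrib distrib_right left_diff_distrib)
    moreover have "real d - 1 = (\<Sum>i=1..n. real (degree (?q i)))"
      using d deg by (simp flip: of_nat_sum)
    ultimately have eq: "(\<Sum>i=1..n. proximity_fun av n d ?f (D i) r / real d)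
        - (real n - 1 + 1 / real d) * characteristic_fun av n ?f r
        = - (\<Sum>i=1..n. ln (?g i r) - real (degree (?q i)) * ln r) / real d"
      by (simp add: sum_subtractf sum_distrib_right)
    have "\<bar>\<Sum>i=1..n. ln (?g i r) - real (degree (?q i)) * ln r\<bar> \<le> (\<Sum>i=1..n. C i)"
      using C r by (intro order_trans[OF sum_abs] sum_mono) blast
    then show ?thesis unfolding eq abs_divide abs_minus_cancel
      using d by (simp add: divide_right_mono)
  qed
  then show ?thesis by (intro exI[of _ "(\<Sum>i=1..n. C i) / real d"] allI impI)
qed

end


section \<open>Coefficients of degenerate systems of forms\<close>

text \<open>
  The indices \<open>(i, j, l)\<close> of the coefficients of \<open>x\<^sub>j\<^sup>d\<^sup>-\<^sup>1 x\<^sub>l\<close> in the \<open>i\<close>-th form that may be chosen freely.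
  The others are given by \<open>fixed_coeff\<close>: they make the restriction to the line equal to \<open>x\<^sub>1\<^sup>d\<close> if
  \<open>i < n\<close>, and make the \<open>n\<close>-th form vanish at \<open>(1 : 0 : \<dots> : 0)\<close>.
\<close>

definition coeff_index :: "nat \<Rightarrow> (nat \<times> nat \<times> nat) set" where
  "coeff_index n = {(i, j, l). 1 \<le> i \<and> i \<le> n \<and> j \<le> n \<and> l \<le> n \<and>
     (2 \<le> j \<or> 2 \<le> l \<or> i = n \<and> (j, l) \<noteq> (0, 0))}"

definition fixed_coeff :: "nat \<Rightarrow> nat \<times> nat \<times> nat \<Rightarrow> 'a::field" where
  "fixed_coeff n = (\<lambda>(i, j, l). if i < n \<and> j = 1 \<and> l = 1 then 1 else 0)"

lemma finite_coeff_index: "finite (coeff_index n)"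
proof (rule finite_subset)
  show "coeff_index n \<subseteq> {..n} \<times> {..n} \<times> {..n}" by (auto simp: coeff_index_def)
qed auto

text \<open>
  The coefficient vectors \<open>c\<close> for which the forms with index in \<open>I\<close> vanish and have dependent gradients at
  some point \<open>p\<close> with \<open>p j = 1\<close>, with multipliers that are 1 at \<open>i\<^sub>0\<close>. Row \<open>j\<close> of the form \<open>i\<^sub>0\<close> and the
  corner \<open>(j, j)\<close> of each form in \<open>I\<close> can be solved for. In the parametrizing vector \<open>y\<close> these entries
  are therefore vacant, and are used to store the entries of \<open>p\<close> other than \<open>p j\<close> and the multipliers
  other than the one of \<open>i\<^sub>0\<close>. Nothing is left to be stored in the entry \<open>(i\<^sub>0, j, j)\<close>, so the
  parametrization has one variable less than there are coefficients.
\<close>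

locale degenerate_chart =
  fixes n d :: nat and S :: "(nat \<times> nat \<times> nat) set" and b :: "nat \<times> nat \<times> nat \<Rightarrow> 'a::field"
    and j i\<^sub>0 :: nat and I :: "nat set"
  assumes I: "finite I" "i\<^sub>0 \<in> I" and j: "j \<le> n"
    and full: "\<And>i l. i \<in> I \<Longrightarrow> l \<le> n \<Longrightarrow> (i, j, l) \<in> S"
    and bounded: "\<And>i j l. (i, j, l) \<in> S \<Longrightarrow> l \<le> n"
begin

definition point :: "(nat \<times> nat \<times> nat \<Rightarrow> 'a) \<Rightarrow> nat \<Rightarrow> 'a" where
  "point y l = (if l = j then 1 else if l \<le> n then y (i\<^sub>0, j, l) else 0)"

definition multiplier :: "(nat \<times> nat \<times> nat \<Rightarrow> 'a) \<Rightarrow> nat \<Rightarrow> 'a" where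
  "multiplier y i = (if i = i\<^sub>0 then 1 else y (i, j, j))"

text \<open>
  Entries outside \<open>S\<close> are not variables and have the prescribed values \<open>b\<close>.
\<close>

definition other_rows where
  "other_rows y i = clear_row j (\<lambda>j' l. if (i, j', l) \<in> S then y (i, j', l) else b (i, j', l))"

text \<open>
  For \<open>i = i\<^sub>0\<close> the solution of \<open>\<Sum>\<^sub>i \<lambda>\<^sub>i \<partial>\<^sub>aQ\<^sub>i(p) = 0\<close> for the coefficient \<open>(i\<^sub>0, j, a)\<close>, where \<open>a \<noteq> j\<close>.
\<close>

definition solved_row where
  "solved_row y i a = (if i = i\<^sub>0
     then - (form_gradient n d (other_rows y i\<^sub>0) (point y) a
       + (\<Sum>i'\<in>I - {i\<^sub>0}. multiplier y i' *
            (form_gradient n d (other_rows y i') (point y) a + y (i', j, a))))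
     else y (i, j, a))"

text \<open>
  The solution of \<open>Q\<^sub>i(p) = 0\<close> for the coefficient \<open>(i, j, j)\<close>, once the rest of row \<open>j\<close> is known.
\<close>

definition solved_corner where
  "solved_corner y i = - (form_value n d (other_rows y i) (point y)
     + (\<Sum>l\<in>{..n} - {j}. solved_row y i l * point y l))"

definition degenerate_coeffs where
  "degenerate_coeffs y = (\<lambda>(i, j', l).
     if j' \<noteq> j then y (i, j', l) else if l \<noteq> j then solved_row y i l
     else if i \<in> I then solved_corner y i else y (i, j', l))"

lemma degenerate_coeffs_poly:
  assumes "s \<in> S"
  shows "(\<lambda>y. degenerate_coeffs y s) \<in> poly_functions (S - {(i\<^sub>0, j, j)})"
proof -
  let ?P = "poly_functions (S - {(i\<^sub>0, j, j)}) :: ((nat \<times> nat \<times> nat \<Rightarrow> 'a) \<Rightarrow> 'a) set"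
  have point: "(\<lambda>y. point y l) \<in> ?P" for l
    unfolding point_def by (intro poly_functions_intros) (use full I in auto)
  have mult: "(\<lambda>y. multiplier y i) \<in> ?P" if "i \<in> I" for i
    unfolding multiplier_def by (intro poly_functions_intros) (use full that j in auto)
  have rows: "(\<lambda>y. other_rows y i j' l) \<in> ?P" for i j' l
    unfolding other_rows_def clear_row_def by (intro poly_functions_intros) auto
  have grad: "(\<lambda>y. form_gradient n d (other_rows y i) (point y) a) \<in> ?P" for i a
    by (intro poly_functions_form_gradient rows point)
  have val: "(\<lambda>y. form_value n d (other_rows y i) (point y)) \<in> ?P" for i
    by (intro poly_functions_form_value rows point)
  have solved: "(\<lambda>y. solved_row y i a) \<in> ?P" if "a \<le> n" "a \<noteq> j" "i \<noteq> i\<^sub>0 \<Longrightarrow> (i, j, a) \<in> S" for i a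
    unfolding solved_row_def
    by (intro poly_functions_intros grad mult) (use full that in auto)
  have corner: "(\<lambda>y. solved_corner y i) \<in> ?P" if "i \<in> I" for i
    unfolding solved_corner_def
    by (intro poly_functions_intros val point solved) (use full that in auto)
  obtain i j' l where s: "s = (i, j', l)" by (cases s)
  consider "j' \<noteq> j" | "j' = j" "l \<noteq> j" | "j' = j" "l = j" "i \<in> I" | "j' = j" "l = j" "i \<notin> I"
    by blast
  then show ?thesis
  proof cases
    case 1
    then show ?thesis using assms
      by (auto simp: degenerate_coeffs_def s intro!: poly_functions.coordinate)
  next
    case 2
    with assms bounded s have "l \<le> n" by blast
    with 2 show ?thesis using assms solved[of l i] by (simp add: degenerate_coeffs_def s)
  next
    case 3
    then show ?thesis using corner by (simp add: degenerate_coeffs_def s)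
  next
    case 4
    then show ?thesis using assms I(2)
      by (auto simp: degenerate_coeffs_def s intro!: poly_functions.coordinate)
  qed
qed

lemma degenerate_coeffs_cover:
  assumes c: "\<And>s. s \<notin> S \<Longrightarrow> c s = b s"
    and p: "p j = 1" "\<And>l. l > n \<Longrightarrow> p l = 0" and m: "m i\<^sub>0 = 1"
    and vanish: "\<And>i. i \<in> I \<Longrightarrow> form_value n d (\<lambda>j l. c (i, j, l)) p = 0"
    and gradient: "\<And>a. a \<le> n \<Longrightarrow>
      (\<Sum>i\<in>I. m i * form_gradient n d (\<lambda>j l. c (i, j, l)) p a) = 0"
  shows "\<exists>y. \<forall>s\<in>S. degenerate_coeffs y s = c s"
proof -
  define y where "y = (\<lambda>(i, j', l). if j' \<noteq> j then c (i, j', l)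
    else if l = j then (if i \<in> I then m i else c (i, j', l))
    else if i = i\<^sub>0 then p l else c (i, j', l))"
  have point: "point y = p"
    using p by (auto simp: fun_eq_iff point_def y_def)
  have mult: "multiplier y i = m i" if "i \<in> I" for i
    using that m by (simp add: multiplier_def y_def)
  have rows: "other_rows y i = clear_row j (\<lambda>j l. c (i, j, l))" for i
    using c by (auto simp: fun_eq_iff other_rows_def clear_row_def y_def)
  have row: "solved_row y i a = c (i, j, a)" if a: "a \<le> n" "a \<noteq> j" for i a
  proof (cases "i = i\<^sub>0")
    case True
    let ?G = "\<lambda>i. form_gradient n d (clear_row j (\<lambda>j l. c (i, j, l))) p a + c (i, j, a)"
    have "form_gradient n d (\<lambda>j l. c (i, j, l)) p a = ?G i" for i
      by (rule form_gradient_row) (use j a p(1) in auto)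
    with gradient[OF a(1)] have "(\<Sum>i\<in>I. m i * ?G i) = 0" by (simp only:)
    then have "?G i\<^sub>0 + (\<Sum>i\<in>I - {i\<^sub>0}. m i * ?G i) = 0"
      using I m by (simp add: sum.remove)
    moreover have "(\<Sum>i\<in>I - {i\<^sub>0}. multiplier y i *
        (form_gradient n d (other_rows y i) (point y) a + y (i, j, a))) = (\<Sum>i\<in>I - {i\<^sub>0}. m i * ?G i)"
      using a by (intro sum.cong refl) (simp add: mult rows point, simp add: y_def)
    ultimately have "form_gradient n d (other_rows y i\<^sub>0) (point y) a
        + (\<Sum>i\<in>I - {i\<^sub>0}. multiplier y i *
            (form_gradient n d (other_rows y i) (point y) a + y (i, j, a))) + c (i\<^sub>0, j, a) = 0"
      by (simp add: rows point add_ac)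
    from minus_unique[OF this] True show ?thesis
      by (simp only: solved_row_def simp_thms if_True)
  next
    case False
    then show ?thesis using a by (simp add: solved_row_def y_def)
  qed
  have corner: "solved_corner y i = c (i, j, j)" if "i \<in> I" for i
  proof -
    have "form_value n d (clear_row j (\<lambda>j l. c (i, j, l))) p + (\<Sum>l\<le>n. c (i, j, l) * p l) = 0"
      using vanish[OF that] form_value_row[where C = "\<lambda>j l. c (i, j, l)" and p = p and d = d, OF j p(1)] by simp
    moreover have "(\<Sum>l\<le>n. c (i, j, l) * p l)
        = (\<Sum>l\<in>{..n} - {j}. solved_row y i l * point y l) + c (i, j, j)"
      using j p(1) by (subst sum.remove[of _ j]) (auto simp: row point)
    ultimately have "form_value n d (other_rows y i) (point y)
        + (\<Sum>l\<in>{..n} - {j}. solved_row y i l * point y l) + c (i, j, j) = 0"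
      by (simp add: rows point add.assoc)
    then show ?thesis unfolding solved_corner_def by (rule minus_unique)
  qed
  have "degenerate_coeffs y (i, j', l) = c (i, j', l)" if "(i, j', l) \<in> S" for i j' l
    using bounded[OF that] row corner by (auto simp: degenerate_coeffs_def y_def)
  then show ?thesis by (intro exI[of _ y]) auto
qed

end
text \<open>
  Covers the coefficients for which the line is tangent to the last hypersurface at \<open>(1 : 0 : \<dots> : 0)\<close>,
  by solving for the coefficient of \<open>x\<^sub>0\<^sup>d\<^sup>-\<^sup>1 x\<^sub>1\<close>.
\<close>

definition last_form_tangent_coeffs ::
    "nat \<Rightarrow> nat \<Rightarrow> (nat \<times> nat \<times> nat \<Rightarrow> 'a::field) \<Rightarrow> nat \<times> nat \<times> nat \<Rightarrow> 'a" where
  "last_form_tangent_coeffs n d y =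
     y((n, 0, 1) := - (if d = 2 then y (n, 1, 0) else 0))"

text \<open>
  Covers the coefficients for which the first \<open>n - 1\<close> forms have dependent gradients at
  \<open>(1 : 0 : \<dots> : 0)\<close>. All these gradients are supported on the coordinates \<open>2, \<dots>, n\<close>, so \<open>n - 1\<close>
  equations are solved for the coefficients \<open>(i\<^sub>0, 0, l)\<close> with \<open>2 \<le> l\<close>. The vacant entry \<open>(i\<^sub>0, 0, i + 1)\<close>
  stores the multiplier of the form \<open>i\<close>; the one of \<open>i\<^sub>0\<close> is 1, which saves the variable \<open>(i\<^sub>0, 0, i\<^sub>0 + 1)\<close>.
\<close>

definition dependent_tangent_coeffs ::
    "nat \<Rightarrow> nat \<Rightarrow> nat \<Rightarrow> (nat \<times> nat \<times> nat \<Rightarrow> 'a::field) \<Rightarrow> nat \<times> nat \<times> nat \<Rightarrow> 'a" where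
  "dependent_tangent_coeffs n d i\<^sub>0 y = (\<lambda>(i, j, l).
     if i = i\<^sub>0 \<and> j = 0
     then - ((\<Sum>i'\<in>{1..<n} - {i\<^sub>0}. y (i\<^sub>0, 0, i' + 1) *
               (y (i', 0, l) + (if d = 2 then y (i', l, 0) else 0)))
             + (if d = 2 then y (i\<^sub>0, l, 0) else 0))
     else y (i, j, l))"

lemma last_form_tangent_coeffs_poly:
  assumes "n \<ge> 1" "s \<in> coeff_index n"
  shows "(\<lambda>y. last_form_tangent_coeffs n d y s) \<in> poly_functions (coeff_index n - {(n, 0, 1)})"
proof (cases "s = (n, 0, 1)")
  case True
  have "(n, 1, 0) \<in> coeff_index n - {(n, 0, 1)}" using assms(1) by (auto simp: coeff_index_def)
  then have "(\<lambda>y. - (if d = 2 then y (n, 1, 0) else 0)) \<in> poly_functions (coeff_index n - {(n, 0, 1)})"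
    by (intro poly_functions_intros)
  then show ?thesis using True by (simp add: last_form_tangent_coeffs_def)
next
  case False
  then show ?thesis
    using assms by (auto simp: last_form_tangent_coeffs_def intro!: poly_functions.coordinate)
qed

lemma dependent_tangent_coeffs_poly:
  assumes "1 \<le> i\<^sub>0" "i\<^sub>0 < n" "s \<in> coeff_index n"
  shows "(\<lambda>y. dependent_tangent_coeffs n d i\<^sub>0 y s)
    \<in> poly_functions (coeff_index n - {(i\<^sub>0, 0, i\<^sub>0 + 1)})"
proof -
  obtain i j l where s: "s = (i, j, l)" by (cases s)
  show ?thesis
  proof (cases "i = i\<^sub>0 \<and> j = 0")
    case True
    then have l: "2 \<le> l" "l \<le> n" using assms by (auto simp: coeff_index_def s)
    show ?thesis
      using True by (simp add: dependent_tangent_coeffs_def s)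
        (intro poly_functions_intros; use assms l in \<open>auto simp: coeff_index_def\<close>)
  next
    case False
    then show ?thesis
      using assms(3)
      by (auto simp: dependent_tangent_coeffs_def s intro!: poly_functions.coordinate)
  qed
qed

lemma dependent_tangent_coeffs_cover:
  assumes i0: "1 \<le> i\<^sub>0" "i\<^sub>0 < n" and m: "m i\<^sub>0 = 1"
    and dep: "\<And>l. 2 \<le> l \<Longrightarrow> l \<le> n \<Longrightarrow>
      (\<Sum>i\<in>{1..<n}. m i * (c (i, 0, l) + (if d = 2 then c (i, l, 0) else 0))) = 0"
  shows "\<exists>y. \<forall>s\<in>coeff_index n. dependent_tangent_coeffs n d i\<^sub>0 y s = c s"
proof -
  define y where "y = (\<lambda>(i, j, l). if i = i\<^sub>0 \<and> j = 0 then m (l - 1) else c (i, j, l))"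
  have "dependent_tangent_coeffs n d i\<^sub>0 y (i, j, l) = c (i, j, l)"
    if ijl: "(i, j, l) \<in> coeff_index n" for i j l
  proof (cases "i = i\<^sub>0 \<and> j = 0")
    case True
    then have l: "2 \<le> l" "l \<le> n" using i0 ijl by (auto simp: coeff_index_def)
    let ?v = "\<lambda>i. c (i, 0, l) + (if d = 2 then c (i, l, 0) else 0)"
    have "(\<Sum>i'\<in>{1..<n} - {i\<^sub>0}. y (i\<^sub>0, 0, i' + 1) *
          (y (i', 0, l) + (if d = 2 then y (i', l, 0) else 0))) = (\<Sum>i\<in>{1..<n} - {i\<^sub>0}. m i * ?v i)"
      by (intro sum.cong refl) (simp add: y_def)
    moreover have "(if d = 2 then y (i\<^sub>0, l, 0) else 0) = (if d = 2 then c (i\<^sub>0, l, 0) else 0)"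
      using l by (simp add: y_def)
    moreover have "?v i\<^sub>0 + (\<Sum>i\<in>{1..<n} - {i\<^sub>0}. m i * ?v i) = 0"
      using dep[OF l] i0 m by (subst (asm) sum.remove[of _ i\<^sub>0]) auto
    ultimately have "(\<Sum>i'\<in>{1..<n} - {i\<^sub>0}. y (i\<^sub>0, 0, i' + 1) *
          (y (i', 0, l) + (if d = 2 then y (i', l, 0) else 0)))
        + (if d = 2 then y (i\<^sub>0, l, 0) else 0) + c (i\<^sub>0, 0, l) = 0"
      by (simp only: add_ac)
    from minus_unique[OF this] True show ?thesis
      by (simp only: dependent_tangent_coeffs_def split_conv simp_thms if_True)
  next
    case False
    then show ?thesis by (auto simp: dependent_tangent_coeffs_def y_def)
  qed
  then show ?thesis by (intro exI[of _ y]) auto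
qed


section \<open>Generic coefficients\<close>

lemma form_value_on_line:
  assumes "n \<ge> 1" "d \<ge> 2" "\<And>l. l \<ge> 2 \<Longrightarrow> p l = 0"
  shows "form_value n d C p = (\<Sum>j\<in>{0, 1}. \<Sum>l\<in>{0, 1}. C j l * (p j ^ (d - 1) * p l))"
proof -
  have "form_value n d C p = (\<Sum>j\<in>{0, 1}. \<Sum>l\<le>n. C j l * (p j ^ (d - 1) * p l))"
    unfolding form_value_def
    by (rule sum.mono_neutral_right) (use assms in \<open>auto simp: power_0_left intro!: sum.neutral\<close>)
  also have "\<dots> = (\<Sum>j\<in>{0, 1}. \<Sum>l\<in>{0, 1}. C j l * (p j ^ (d - 1) * p l))"
    by (intro sum.cong refl sum.mono_neutral_right) (use assms in auto)
  finally show ?thesis .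
qed

text \<open>
  A degenerate point \<open>p\<close> off the line has \<open>p j \<noteq> 0\<close> for some \<open>j \<ge> 2\<close>, where all entries of row \<open>j\<close> are
  free. On the line and away from \<open>(1 : 0 : \<dots> : 0)\<close> the forms with \<open>i < n\<close> do not vanish, and for the
  last form row 1 is free. This leaves the point \<open>(1 : 0 : \<dots> : 0)\<close>: there the last form is the only one
  whose derivative along the line can be nonzero, so once it is nonzero a relation between the gradients
  involves only the others.
\<close>

lemma generic_coefficients:
  assumes n: "n \<ge> 1" and d: "d \<ge> 2"
  obtains c :: "nat \<times> nat \<times> nat \<Rightarrow> 'a::alg_closed_field"
  where "\<And>s. s \<notin> coeff_index n \<Longrightarrow> c s = fixed_coeff n s"
    and "independent_gradients n {1..n} (\<lambda>i. near_power_form n d (\<lambda>j l. c (i, j, l)))"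
    and "c (n, 0, 1) + (if d = 2 then c (n, 1, 0) else 0) \<noteq> 0"
proof -
  let ?S = "coeff_index n" and ?b = "fixed_coeff n :: _ \<Rightarrow> 'a"
  let ?chart = "\<lambda>(j, i\<^sub>0, I). degenerate_chart.degenerate_coeffs n d ?S ?b j i\<^sub>0 I"
  have chart: "degenerate_chart n ?S j i\<^sub>0 I"
    if "2 \<le> j \<and> I \<subseteq> {1..n} \<or> j = 1 \<and> I = {n}" "j \<le> n" "i\<^sub>0 \<in> I" for j i\<^sub>0 I
    using that n by unfold_locales (auto simp: coeff_index_def intro: finite_subset)
  define \<C> where "\<C> = {(j, i\<^sub>0, I). j \<le> n \<and> i\<^sub>0 \<in> I \<and> I \<subseteq> {1..n} \<and> (2 \<le> j \<or> j = 1 \<and> I = {n})}"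
  have fin: "finite \<C>"
  proof (rule finite_subset)
    show "\<C> \<subseteq> {..n} \<times> {..n} \<times> Pow {1..n}" by (auto simp: \<C>_def)
  qed auto
  let ?\<F> = "insert (last_form_tangent_coeffs n d)
    (dependent_tangent_coeffs n d ` {1..<n} \<union> ?chart ` \<C>)"
  from fin have "finite ?\<F>" by simp
  have poly: "\<exists>s\<^sub>0\<in>?S. \<forall>s\<in>?S. (\<lambda>y. F y s) \<in> poly_functions (?S - {s\<^sub>0})" if "F \<in> ?\<F>" for F
    using that
  proof (elim insertE UnE imageE)
    assume F: "F = last_form_tangent_coeffs n d"
    have "(n, 0, 1) \<in> ?S" using n by (auto simp: coeff_index_def)
    then show ?thesis unfolding F by (rule bexI[rotated]) (blast intro: last_form_tangent_coeffs_poly n)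
  next
    fix i assume F: "F = dependent_tangent_coeffs n d i" and i: "i \<in> {1..<n}"
    have "(i, 0, i + 1) \<in> ?S" using i by (auto simp: coeff_index_def)
    then show ?thesis unfolding F
      by (rule bexI[rotated]) (use i in \<open>auto intro!: dependent_tangent_coeffs_poly[simplified]\<close>)
  next
    fix x assume F: "F = ?chart x" and "x \<in> \<C>"
    then obtain j i\<^sub>0 I where x: "x = (j, i\<^sub>0, I)" and C: "j \<le> n" "i\<^sub>0 \<in> I" "I \<subseteq> {1..n}"
      "2 \<le> j \<or> j = 1 \<and> I = {n}" by (auto simp: \<C>_def)
    interpret degenerate_chart n d ?S ?b j i\<^sub>0 I by (rule chart) (use C in auto)
    have "(i\<^sub>0, j, j) \<in> ?S" using full I j by blast
    then show ?thesis unfolding F x prod.case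
      by (rule bexI[rotated]) (blast intro: degenerate_coeffs_poly)
  qed
  obtain c :: "nat \<times> nat \<times> nat \<Rightarrow> 'a" where c: "\<And>s. s \<notin> ?S \<Longrightarrow> c s = ?b s"
    and avoid: "\<And>F y. F \<in> ?\<F> \<Longrightarrow> \<exists>s\<in>?S. F y s \<noteq> c s"
    by (rule point_outside_polynomial_images
        [OF finite_coeff_index \<open>finite ?\<F>\<close> poly, where b = ?b], assumption, rule that)
  let ?C = "\<lambda>i j l. c (i, j, l)"
  have c_line: "c (i, 0, 0) = 0" "c (i, 0, 1) = 0" "c (i, 1, 0) = 0" "c (i, 1, 1) = 1"
    if "i < n" for i
    using that c by (auto simp: coeff_index_def fixed_coeff_def)
  have last: "c (n, 0, 1) + (if d = 2 then c (n, 1, 0) else 0) \<noteq> 0"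
  proof
    assume "c (n, 0, 1) + (if d = 2 then c (n, 1, 0) else 0) = 0"
    then have "c (n, 0, 1) = - (if d = 2 then c (n, 1, 0) else 0)"
      by (simp only: eq_neg_iff_add_eq_0)
    then have "last_form_tangent_coeffs n d c = c"
      unfolding last_form_tangent_coeffs_def by (intro fun_upd_idem)
    then show False using avoid[OF insertI1, of c] by simp
  qed
  have "independent_gradients n {1..n} (\<lambda>i. near_power_form n d (?C i))"
    unfolding independent_gradients_def eval_near_power_form eval_pderiv_near_power_form
  proof (intro ballI allI impI, rule ccontr)
    fix p :: "nat \<Rightarrow> 'a" and l k
    assume p: "p \<in> hom_coords n"
      and "(\<forall>i\<in>{1..n}. l i \<noteq> 0 \<longrightarrow> form_value n d (?C i) p = 0) \<and>
        (\<forall>a\<le>n. (\<Sum>i\<in>{1..n}. l i * form_gradient n d (?C i) p a) = 0)"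
      and k: "k \<in> {1..n}" "l k \<noteq> 0"
    then have vanish: "\<And>i. i \<in> {1..n} \<Longrightarrow> l i \<noteq> 0 \<Longrightarrow> form_value n d (?C i) p = 0"
      and gradient: "\<And>a. a \<le> n \<Longrightarrow> (\<Sum>i\<in>{1..n}. l i * form_gradient n d (?C i) p a) = 0"
      by blast+
    define I where "I = {i \<in> {1..n}. l i \<noteq> 0}"
    have p_0: "p i = 0" if "i > n" for i
      using p that by (auto simp: hom_coords_def coord_space_def)
    \<comment> \<open>Rescaling the point and the multipliers brings them into the form covered by a chart.\<close>
    have no_chart: False if nonzero: "j \<le> n" "p j \<noteq> 0" and rows: "2 \<le> j \<or> j = 1 \<and> I = {n}" for j
    proof -
      interpret degenerate_chart n d ?S ?b j k I
        by (rule chart) (use nonzero rows k in \<open>auto simp: I_def\<close>)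
      let ?p = "\<lambda>i. inverse (p j) * p i" and ?m = "\<lambda>i. l i / l k"
      have "\<exists>y. \<forall>s\<in>?S. degenerate_coeffs y s = c s"
      proof (rule degenerate_coeffs_cover[of c ?p ?m, OF c])
        show "form_value n d (?C i) ?p = 0" if "i \<in> I" for i
          using that vanish d by (simp add: form_value_scale I_def)
        show "(\<Sum>i\<in>I. ?m i * form_gradient n d (?C i) ?p a) = 0" if "a \<le> n" for a
        proof -
          have "(\<Sum>i\<in>I. ?m i * form_gradient n d (?C i) ?p a)
              = (\<Sum>i\<in>{1..n}. ?m i * form_gradient n d (?C i) ?p a)"
            by (rule sum.mono_neutral_left) (auto simp: I_def)
          also have "\<dots> = inverse (p j) ^ (d - 1) / l k
              * (\<Sum>i\<in>{1..n}. l i * form_gradient n d (?C i) p a)"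
            unfolding form_gradient_scale[OF d] sum_distrib_left
            by (intro sum.cong refl) (simp add: field_simps)
          finally show ?thesis using gradient[OF that] by simp
        qed
      qed (use nonzero k p_0 in auto)
      moreover have "(j, k, I) \<in> \<C>"
        using nonzero rows k by (auto simp: \<C>_def I_def)
      then have "degenerate_coeffs \<in> ?\<F>" by force
      ultimately show False using avoid by blast
    qed
    have line: "p j = 0" if "j \<ge> 2" for j
      using no_chart[of j] p_0[of j] that by (cases "j \<le> n") auto
    have "p 1 = 0"
    proof (rule ccontr)
      assume p1: "p 1 \<noteq> 0"
      have "i = n" if i: "i \<in> I" for i
      proof (rule ccontr)
        assume "i \<noteq> n"
        then have "i < n" using i by (auto simp: I_def)
        have "form_value n d (?C i) p = p 1 ^ (d - 1) * p 1"
          using c_line[OF \<open>i < n\<close>] by (simp add: form_value_on_line[OF n d line])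
        with vanish[of i] i p1 show False by (simp add: I_def)
      qed
      moreover have "k \<in> I" using k by (simp add: I_def)
      ultimately have "I = {n}" by blast
      with no_chart[of 1] n p1 show False by blast
    qed
    have p0: "p 0 \<noteq> 0"
    proof
      assume "p 0 = 0"
      have "p i = 0" for i
        using \<open>p 0 = 0\<close> \<open>p 1 = 0\<close> line[of i] by (cases i; cases "i = 1") auto
      then have "p = (\<lambda>_. 0)" by auto
      then show False using p by (simp add: hom_coords_def)
    qed
    let ?p = "\<lambda>i. inverse (p 0) * p i"
    let ?v = "\<lambda>i a. c (i, 0, a) + (if d = 2 then c (i, a, 0) else 0)"
    \<comment> \<open>Here \<open>p\<close> is a multiple of the first unit vector.\<close>
    have tangent: "(\<Sum>i\<in>{1..n}. l i * ?v i a) = 0" if a: "1 \<le> a" "a \<le> n" for a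
    proof -
      have p': "?p l = 0" if "l \<noteq> 0" for l
        using line[of l] \<open>p 1 = 0\<close> that by (cases "l = 1") auto
      have "(\<Sum>i\<in>{1..n}. l i * ?v i a) = (\<Sum>i\<in>{1..n}. l i * form_gradient n d (?C i) ?p a)"
        using p0 p' by (intro sum.cong refl) (subst form_gradient_base_point[OF d a], auto)
      also have "\<dots> = inverse (p 0) ^ (d - 1) * (\<Sum>i\<in>{1..n}. l i * form_gradient n d (?C i) p a)"
        unfolding form_gradient_scale[OF d] sum_distrib_left
        by (intro sum.cong refl) (simp add: mult.left_commute)
      finally show ?thesis using gradient[OF a(2)] by simp
    qed
    have split: "{1..n} = insert n {1..<n}" using n by auto
    have "l n = 0"
    proof -
      have "(\<Sum>i\<in>{1..<n}. l i * ?v i 1) = 0"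
        using c_line by (intro sum.neutral) auto
      then have "l n * ?v n 1 = 0"
        using tangent[of 1] n unfolding split by simp
      then show ?thesis using last by simp
    qed
    with k have k': "1 \<le> k" "k < n" by (auto simp: le_less)
    have "(\<Sum>i\<in>{1..<n}. (l i / l k) * ?v i a) = 0" if a: "2 \<le> a" "a \<le> n" for a
    proof -
      have "(\<Sum>i\<in>{1..<n}. l i * ?v i a) = 0"
        using tangent[of a] a \<open>l n = 0\<close> unfolding split by simp
      then have "(\<Sum>i\<in>{1..<n}. l i * ?v i a) / l k = 0" by simp
      then show ?thesis by (simp add: sum_divide_distrib)
    qed
    then have "\<exists>y. \<forall>s\<in>?S. dependent_tangent_coeffs n d k y s = c s"
      using k(2) by (intro dependent_tangent_coeffs_cover[OF k', of "\<lambda>i. l i / l k"]) auto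
    moreover have "dependent_tangent_coeffs n d k \<in> ?\<F>" using k' by auto
    ultimately show False using avoid by blast
  qed
  from c this last show thesis by (rule that)
qed


section \<open>Hypersurfaces with maximal proximity\<close>

lemma hypersurface_near_power_form:
  assumes "d \<ge> 1" "nonsingular_hypersurface n (near_power_form n d C)"
  shows "hypersurface n d (near_power_form n d C)"
proof -
  have "near_power_form n d C \<noteq> 0"
  proof
    assume zero: "near_power_form n d C = 0"
    have "(\<lambda>i. if i = 0 then 1 else 0 :: 'a) \<in> hom_coords n"
      by (auto simp: hom_coords_def coord_space_def fun_eq_iff)
    then show False
      using assms(2) unfolding nonsingular_hypersurface_def zero
      by (auto simp: mpol_eval_def mpol_subst_def mpol_pderiv_def)
  qed
  then show ?thesis
    using homogeneous_near_power_form[OF assms(1)] by (simp add: hypersurface_def)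
qed

text \<open>
  The degrees of the compositions with the line map add up to \<open>d - 1\<close>, all of it coming from the last
  form.
\<close>

lemma forms_with_maximal_proximity:
  fixes av :: "'a::alg_closed_field \<Rightarrow> real" and C :: "nat \<Rightarrow> nat \<Rightarrow> nat \<Rightarrow> 'a"
  assumes av: "nonarch_abs av" and n: "n \<ge> 1" and d: "d \<ge> 1"
    and ind: "independent_gradients n {1..n} (\<lambda>i. near_power_form n d (C i))"
    and unit: "\<And>i. i \<in> {1..<n} \<Longrightarrow> mpol_poly (near_power_form n d (C i)) line_map = 1"
    and last: "mpol_poly (near_power_form n d (C n)) line_map \<noteq> 0"
      "degree (mpol_poly (near_power_form n d (C n)) line_map) = d - 1"
  shows "\<exists>(D :: nat \<Rightarrow> 'a mpol) (f :: nat \<Rightarrow> 'a fps).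
    (\<forall>i\<in>{1..n}. hypersurface n d (D i) \<and> nonsingular_hypersurface n (D i)) \<and>
    intersect_transversally n {1..n} D \<and>
    analytic_map av n f \<and> nonconstant_map av n f \<and>
    (\<forall>i\<in>{1..n}. \<not> image_contained_in av f (D i)) \<and>
    (\<exists>C::real. \<forall>r::real. r \<ge> 1 \<longrightarrow>
      \<bar>(\<Sum>i=1..n. proximity_fun av n d f (D i) r / real d)
        - (real n - 1 + 1 / real d) * characteristic_fun av n f r\<bar> \<le> C)"
proof -
  let ?D = "\<lambda>i. near_power_form n d (C i)" and ?f = "\<lambda>i. fps_of_poly (line_map i) :: 'a fps"
  let ?q = "\<lambda>i. mpol_poly (?D i) line_map"
  have split: "{1..n} = insert n {1..<n}" using n by auto
  have nonzero: "?q i \<noteq> 0" if "i \<in> {1..n}" for i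
    using that unit last(1) unfolding split by auto
  have "(\<Sum>i=1..n. degree (?q i)) = d - 1"
    unfolding split using unit last(2) by simp
  note proximity = proximity_sum_line_map[OF av n d nonzero this]
  have nonsing: "nonsingular_hypersurface n (?D i)" if "i \<in> {1..n}" for i
    by (rule independent_gradients_imp_nonsingular[OF ind _ that]) simp
  have "\<not> image_contained_in av ?f (?D i)" if "i \<in> {1..n}" for i
  proof
    assume "image_contained_in av ?f (?D i)"
    then have "{z. poly (?q i) z = 0} = UNIV"
      by (simp add: image_contained_in_def map_value_def fps_value_fps_of_poly[OF av] mpol_eval_poly)
    with poly_roots_finite[OF nonzero[OF that]] infinite_UNIV_alg_closed_field show False by metis
  qed
  moreover have "intersect_transversally n {1..n} ?D"
    by (rule independent_gradients_imp_transversal[OF ind]) auto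
  ultimately show ?thesis
    using nonsing hypersurface_near_power_form[OF d] analytic_line_map[OF av n]
      nonconstant_line_map[OF av n] proximity
    by (intro exI[of _ ?D] exI[of _ ?f] conjI ballI) blast+
qed

text \<open>
  For \<open>d = 1\<close>: the linear forms \<open>x\<^sub>1 + x\<^sub>i\<^sub>+\<^sub>1\<close> for \<open>i < n\<close>, and \<open>x\<^sub>1\<close> for \<open>i = n\<close>. As \<open>x\<^sub>j\<^sup>d\<^sup>-\<^sup>1 = 1\<close>, every row
  \<open>j\<close> could carry these coefficients; with rows 0 and 1 the restriction to the line is given by the same
  formula as for \<open>d \<ge> 2\<close>.
\<close>

definition hyperplane_coeffs :: "nat \<Rightarrow> nat \<Rightarrow> nat \<Rightarrow> nat \<Rightarrow> 'a::field" where
  "hyperplane_coeffs n i j l =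
     (if i < n \<and> j = 1 \<and> l = 1 \<or> j = 0 \<and> l = (if i < n then i + 1 else 1) then 1 else 0)"

lemma form_gradient_hyperplane:
  assumes "n \<ge> 1"
  shows "form_gradient n 1 (hyperplane_coeffs n i) p a =
    (if a \<le> n \<and> i < n \<and> a = 1 then 1 else 0) + (if a \<le> n \<and> a = (if i < n then i + 1 else 1) then 1 else 0)"
proof -
  have "form_gradient n 1 (hyperplane_coeffs n i) p a
      = (\<Sum>j\<le>n. \<Sum>l\<le>n. if a = l then hyperplane_coeffs n i j l else 0)"
    unfolding form_gradient_def by (intro sum.cong refl) auto
  also have "\<dots> = (\<Sum>j\<le>n. if a \<le> n then hyperplane_coeffs n i j a else 0)" by simp
  also have "\<dots> = (\<Sum>j\<in>{0, 1}. if a \<le> n then hyperplane_coeffs n i j a else 0)"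
    by (rule sum.mono_neutral_right) (use assms in \<open>auto simp: hyperplane_coeffs_def\<close>)
  also have "\<dots> = (if a \<le> n \<and> i < n \<and> a = 1 then 1 else 0)
      + (if a \<le> n \<and> a = (if i < n then i + 1 else 1) then 1 else 0)"
    by (auto simp: hyperplane_coeffs_def)
  finally show ?thesis .
qed

lemma independent_gradients_hyperplanes:
  assumes n: "n \<ge> 1"
  shows "independent_gradients n {1..n} (\<lambda>i. near_power_form n 1 (hyperplane_coeffs n i :: _ \<Rightarrow> _ \<Rightarrow> 'a::field))"
  unfolding independent_gradients_def eval_near_power_form eval_pderiv_near_power_form
    form_gradient_hyperplane[OF n]
proof (intro ballI allI impI, elim conjE)
  fix p :: "nat \<Rightarrow> 'a" and l :: "nat \<Rightarrow> 'a" and k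
  assume "\<forall>a\<le>n. (\<Sum>i\<in>{1..n}. l i * ((if a \<le> n \<and> i < n \<and> a = 1 then 1 else 0)
      + (if a \<le> n \<and> a = (if i < n then i + 1 else 1) then 1 else 0))) = 0" and k: "k \<in> {1..n}"
  then have *: "(\<Sum>i\<in>{1..n}. l i * ((if a \<le> n \<and> i < n \<and> a = 1 then 1 else 0)
      + (if a \<le> n \<and> a = (if i < n then i + 1 else 1) then 1 else 0))) = 0" if "a \<le> n" for a
    using that by blast
  have small: "l i = 0" if i: "i \<in> {1..<n}" for i
  proof -
    have "(\<Sum>i'\<in>{1..n}. l i' * ((if i + 1 \<le> n \<and> i' < n \<and> i + 1 = 1 then 1 else 0)
        + (if i + 1 \<le> n \<and> i + 1 = (if i' < n then i' + 1 else 1) then 1 else 0)))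
        = (\<Sum>i'\<in>{1..n}. if i' = i then l i else 0)"
      using i by (intro sum.cong refl) auto
    with *[of "i + 1"] i show ?thesis by simp
  qed
  show "l k = 0"
  proof (cases "k < n")
    case True
    then show ?thesis using small k by simp
  next
    case False
    have "(\<Sum>i\<in>{1..n}. l i * ((if 1 \<le> n \<and> i < n \<and> (1::nat) = 1 then 1 else 0)
        + (if 1 \<le> n \<and> 1 = (if i < n then i + 1 else 1) then 1 else 0)))
        = (\<Sum>i\<in>{1..n}. if i = n then l n else 0)"
      using n small by (intro sum.cong refl) auto
    with *[OF n] n False k show ?thesis by simp
  qed
qed

theorem theorem12:
  fixes av :: "'a::alg_closed_field \<Rightarrow> real" and n d :: nat
  assumes "nonarch_abs av" and "complete_abs av"
    and "n \<ge> 1" and "d \<ge> 1"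
  shows "\<exists>(D :: nat \<Rightarrow> 'a mpol) (f :: nat \<Rightarrow> 'a fps).
    (\<forall>i\<in>{1..n}. hypersurface n d (D i) \<and> nonsingular_hypersurface n (D i)) \<and>
    intersect_transversally n {1..n} D \<and>
    analytic_map av n f \<and> nonconstant_map av n f \<and>
    (\<forall>i\<in>{1..n}. \<not> image_contained_in av f (D i)) \<and>
    (\<exists>C::real. \<forall>r::real. r \<ge> 1 \<longrightarrow>
      \<bar>(\<Sum>i=1..n. proximity_fun av n d f (D i) r / real d)
        - (real n - 1 + 1 / real d) * characteristic_fun av n f r\<bar> \<le> C)"
proof (cases "d = 1")
  case True
  have line: "mpol_poly (near_power_form n 1 (hyperplane_coeffs n i)) line_map = (1 :: 'a poly)"
    if "i \<in> {1..n}" for i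
    using that assms(3)
    by (subst near_power_form_line_map)
      (auto simp: hyperplane_coeffs_def monom_altdef one_pCons)
  show ?thesis unfolding True
    by (rule forms_with_maximal_proximity[OF assms(1,3) order_refl
          independent_gradients_hyperplanes[OF assms(3)]])
      (use assms(3) line in auto)
next
  case False
  with assms(4) have d: "d \<ge> 2" by simp
  obtain c :: "nat \<times> nat \<times> nat \<Rightarrow> 'a"
    where c: "\<And>s. s \<notin> coeff_index n \<Longrightarrow> c s = fixed_coeff n s"
      and ind: "independent_gradients n {1..n} (\<lambda>i. near_power_form n d (\<lambda>j l. c (i, j, l)))"
      and last: "c (n, 0, 1) + (if d = 2 then c (n, 1, 0) else 0) \<noteq> 0"
    by (rule generic_coefficients[OF assms(3) d, where 'a = 'a]) (rule that)
  have line: "mpol_poly (near_power_form n d (\<lambda>j l. c (i, j, l))) line_map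
      = monom (c (i, 0, 1)) (d - 1) + [:c (i, 1, 1), c (i, 1, 0):]" for i
    using assms(3) d c[of "(i, 0, 0)"]
    by (intro near_power_form_line_map) (auto simp: coeff_index_def fixed_coeff_def)
  let ?q = "monom (c (n, 0, 1)) (d - 1) + [:c (n, 1, 1), c (n, 1, 0):]"
  have top: "coeff ?q (d - 1) \<noteq> 0"
    using d last by (cases "d = 2") (auto simp: coeff_pCons split: nat.split)
  then have "?q \<noteq> 0" by (metis coeff_0)
  moreover have "degree ?q \<le> d - 1"
    using d by (intro degree_add_le degree_monom_le) (auto intro: order_trans[OF degree_pCons_le])
  then have "degree ?q = d - 1" using le_degree[OF top] by (rule antisym)
  ultimately have q: "?q \<noteq> 0" "degree ?q = d - 1" by blast+
  show ?thesis
    by (rule forms_with_maximal_proximity[OF assms(1,3,4) ind])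
      (use q c in \<open>auto simp: line coeff_index_def fixed_coeff_def one_pCons\<close>)
qed

end
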